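(* Let $\Psi:\mathbb{R}^{m\times n}\to\mathbb{R}^{d\times \ell}$ be a bounded linear operator with adjoint $\Psi^{*}$, let $F\in\mathbb{R}^{d\times\ell}$, let $W\in\mathbb{R}^{d\times\ell}$ have non-negative entries, let $\widetilde W=W\odot W$, and let $\tau>0$. Set $$f(X)=\tfrac12\|(\Psi(X)-F)\odot W\|^2,\qquad g(X)=\|X\|_{*}\qquad (X\in\mathbb{R}^{m\times n}),$$ $L=\|\Psi\|^2\max_{i,j}\widetilde W_{i,j}>0$, and $\gamma\in\,]0,2/L[$. Let $\{X_k\},\{Y_k\},\{Z_k\}$ be sequences generated by Algorithm ProGrAMMe (described in the context) with parameters $\gamma$, $\tau$, $r$, $I$ and inertial parameters $a_k\in[0,1]$. Define $$R_{k+1}=\mathrm{prox}_{\tau\gamma\|\cdot\|_{*}}(Z_k),\qquad e_k=X_{k+1}-R_{k+1}.$$ Suppose that $$\limsup_{k}a_k<1,\qquad \sum_{k\in\mathbb{N}}a_k\|X_k-X_{k-1}\|^2<+\infty,\qquad \sum_{k\in\mathbb{N}}k\,\|e_k\|<+\infty .$$ Then $R_k$ converges to some $X^\star\in\operatorname{Arg\,min}(f+\tau g)$. If, moreover, the non-degeneracy condition $$-\Psi^{*}\big((\Psi(X^\star)-F)\odot\widetilde W\big)\in\tau\,\mathrm{ri}\big(\partial\|X^\star\|_{*}\big)$$ holds for this limit $X^\star$, then there exists $K>0$ such that for all $k\ge K$, $$\mathrm{rank}(R_k)=\mathrm{rank}(X^\star).$$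
   Context: Notation: $\|\cdot\|$ applied to a matrix is the Frobenius norm; $\|\Psi\|$ is the operator norm; $\odot$ is the Hadamard (entrywise) product; $\|\cdot\|_{*}$ is the nuclear norm (sum of singular values) and $\partial\|\cdot\|_*$ its convex subdifferential; $\mathrm{ri}$ denotes relative interior; $\mathrm{Id}_r$ is the $r\times r$ identity. For a proper closed convex function $h$ and $\gamma>0$, $\mathrm{prox}_{\gamma h}(Y)=\arg\min_X\{\gamma h(X)+\tfrac12\|X-Y\|^2\}$. Algorithm ProGrAMMe (proximal gradient and alternating minimization method): fix integers $r\geq 1$ and $I\ge 1$ and starting points $X_{-1},X_0\in\mathbb{R}^{m\times n}$. For $k=0,1,2,\dots$: 1. $Y_k=X_k+a_k(X_k-X_{k-1})$; 2. $Z_k=Y_k-\gamma\,\Psi^{*}\big((\Psi(Y_k)-F)\odot\widetilde W\big)$; 3. initialize $U_0\in\mathbb{R}^{m\times r}$, $V_0\in\mathbb{R}^{r\times n}$ (any choice, possibly depending on $k$), and for $i=0,\dots,I-1$ set $U_{i+1}=Z_kV_i^\top(V_iV_i^\top+\tau\gamma\,\mathrm{Id}_r)^{-1}$ and $V_{i+1}=(U_{i+1}^\top U_{i+1}+\tau\gamma\,\mathrm{Id}_r)^{-1}U_{i+1}^\top Z_k$; 4. $X_{k+1}=U_IV_I$. Step 3 performs $I$ steps of alternating minimization on $\min_{U,V}\tfrac12\|UV-Z_k\|^2+\tfrac{\tau\gamma}{2}(\|U\|^2+\|V\|^2)$. *)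

theory Defs
  imports "HOL-Analysis.Analysis"
begin

text \<open>
  A real \<open>m \<times> n\<close> matrix is a value of type \<^typ>\<open>real ^ 'n ^ 'm\<close>. On this type \<^const>\<open>norm\<close> and
  \<^const>\<open>inner\<close> are the Frobenius norm and inner product, so \<^const>\<open>onorm\<close> and \<^const>\<open>adjoint\<close>
  are the operator norm and the adjoint with respect to them.
\<close>

definition hadamard :: "real ^ 'n ^ 'm \<Rightarrow> real ^ 'n ^ 'm \<Rightarrow> real ^ 'n ^ 'm"  (infixl "\<odot>" 70)
  where "A \<odot> B = (\<chi> i j. A $ i $ j * B $ i $ j)"

definition singular_space :: "real ^ 'n ^ 'm \<Rightarrow> real \<Rightarrow> (real ^ 'n) set"
  where "singular_space A s = {v. (transpose A ** A) *v v = s\<^sup>2 *\<^sub>R v}"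

definition singular_values :: "real ^ 'n ^ 'm \<Rightarrow> real set"
  where "singular_values A = {s. 0 \<le> s \<and> (\<exists>v \<in> singular_space A s. v \<noteq> 0)}"

lemma finite_singular_values: "finite (singular_values A)"
proof -
  have "\<forall>s \<in> singular_values A. \<exists>v. v \<in> singular_space A s \<and> v \<noteq> 0"
    by (auto simp: singular_values_def)
  then obtain v where v: "\<And>s. s \<in> singular_values A \<Longrightarrow> v s \<in> singular_space A s \<and> v s \<noteq> 0"
    by metis
  have sym: "((transpose A ** A) *v x) \<bullet> y = x \<bullet> ((transpose A ** A) *v y)" for x y
    by (metis dot_lmul_matrix matrix_transpose_mul transpose_matrix_vector transpose_transpose)
  have orth: "v s \<bullet> v t = 0"
    if "s \<in> singular_values A" "t \<in> singular_values A" "s \<noteq> t" for s t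
  proof -
    have "s\<^sup>2 * (v s \<bullet> v t) = t\<^sup>2 * (v s \<bullet> v t)"
      using sym[of "v s" "v t"] v[OF that(1)] v[OF that(2)] by (simp add: singular_space_def)
    moreover have "s\<^sup>2 \<noteq> t\<^sup>2"
      using that by (simp add: singular_values_def power2_eq_iff_nonneg)
    ultimately show ?thesis by simp
  qed
  have inj: "inj_on v (singular_values A)"
    by (rule inj_onI) (metis inner_eq_zero_iff orth v)
  have "pairwise orthogonal (v ` singular_values A)"
    unfolding pairwise_def orthogonal_def using orth by auto
  then have "finite (v ` singular_values A)"
    by (rule pairwise_orthogonal_imp_finite)
  then show ?thesis
    using inj finite_imageD by blast
qed

text \<open>
  The singular values are counted with multiplicity. The type \<^typ>\<open>real ^ 'n ^ 'm\<close> of \<open>A\<close> yields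
  \<open>n\<close> of them rather than \<open>min m n\<close>, but the additional ones are zero.
\<close>

definition nuclear_norm :: "real ^ 'n ^ 'm \<Rightarrow> real"
  where "nuclear_norm A = (\<Sum>s \<in> singular_values A. real (dim (singular_space A s)) * s)"

definition subdifferential :: "('a::real_inner \<Rightarrow> real) \<Rightarrow> 'a \<Rightarrow> 'a set"
  where "subdifferential h x = {g. \<forall>y. h x + g \<bullet> (y - x) \<le> h y}"

definition prox :: "real \<Rightarrow> ('a::real_inner \<Rightarrow> real) \<Rightarrow> 'a \<Rightarrow> 'a"
  where "prox \<gamma> h y = (ARG_MIN (\<lambda>x. \<gamma> * h x + 1/2 * (norm (x - y))\<^sup>2) x. True)"

definition data_fidelity ::
    "(real ^ 'n ^ 'm \<Rightarrow> real ^ 'l ^ 'd) \<Rightarrow> real ^ 'l ^ 'd \<Rightarrow> real ^ 'l ^ 'd \<Rightarrow> real ^ 'n ^ 'm \<Rightarrow> real"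
  where "data_fidelity \<Psi> F W X = 1/2 * (norm ((\<Psi> X - F) \<odot> W))\<^sup>2"

text \<open>
  \<open>prev_iter X' X k\<close> is \<open>X\<^bsub>k-1\<^esub>\<close>, where \<open>X'\<close> is the extra starting point \<open>X\<^bsub>-1\<^esub>\<close>.
\<close>

definition prev_iter :: "'a \<Rightarrow> (nat \<Rightarrow> 'a) \<Rightarrow> nat \<Rightarrow> 'a"
  where "prev_iter X' X k = (case k of 0 \<Rightarrow> X' | Suc j \<Rightarrow> X j)"

text \<open>
  \<open>U k i\<close> and \<open>V k i\<close> are the \<open>i\<close>-th inner iterates of the outer step \<open>k\<close>; \<open>U k 0\<close> and \<open>V k 0\<close> are
  arbitrary. The rank parameter \<open>r\<close> is the size of the index type \<^typ>\<open>'r\<close>.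
\<close>

definition ProGrAMMe ::
    "(real ^ 'n ^ 'm \<Rightarrow> real ^ 'l ^ 'd) \<Rightarrow> real ^ 'l ^ 'd \<Rightarrow> real ^ 'l ^ 'd \<Rightarrow> real \<Rightarrow> real \<Rightarrow> nat \<Rightarrow>
     (nat \<Rightarrow> real) \<Rightarrow> real ^ 'n ^ 'm \<Rightarrow> (nat \<Rightarrow> real ^ 'n ^ 'm) \<Rightarrow> (nat \<Rightarrow> real ^ 'n ^ 'm) \<Rightarrow>
     (nat \<Rightarrow> real ^ 'n ^ 'm) \<Rightarrow> (nat \<Rightarrow> nat \<Rightarrow> real ^ 'r ^ 'm) \<Rightarrow> (nat \<Rightarrow> nat \<Rightarrow> real ^ 'n ^ 'r) \<Rightarrow> bool"
  where "ProGrAMMe \<Psi> F Wt \<gamma> \<tau> I a X' X Y Z U V \<longleftrightarrow>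
    (\<forall>k. Y k = X k + a k *\<^sub>R (X k - prev_iter X' X k) \<and>
         Z k = Y k - \<gamma> *\<^sub>R adjoint \<Psi> ((\<Psi> (Y k) - F) \<odot> Wt) \<and>
         (\<forall>i<I.
            U k (Suc i) = Z k ** transpose (V k i)
                          ** matrix_inv (V k i ** transpose (V k i) + (\<tau> * \<gamma>) *\<^sub>R mat 1) \<and>
            V k (Suc i) = matrix_inv (transpose (U k (Suc i)) ** U k (Suc i) + (\<tau> * \<gamma>) *\<^sub>R mat 1)
                          ** transpose (U k (Suc i)) ** Z k) \<and>
         X (Suc k) = U k I ** V k I)"

end

theory Submission
  imports Defs
begin

text \<open>
  The iteration is \<open>X\<^bsub>k+1\<^esub> = T Y\<^bsub>k\<^esub> + e\<^bsub>k\<^esub>\<close>, where \<open>T\<close> is the forward-backward map, whose fixed points are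
  the minimisers of \<open>f + \<tau> g\<close>. Firm nonexpansiveness of the proximal map and cocoercivity of the
  gradient give \<open>\<parallel>T z - p\<parallel>\<^sup>2 + c \<parallel>z - T z\<parallel>\<^sup>2 \<le> \<parallel>z - p\<parallel>\<^sup>2\<close> for some \<open>c > 0\<close> and every fixed point \<open>p\<close>.
  Hence the distances to \<open>p\<close> converge and \<open>Y\<^bsub>k\<^esub> - T Y\<^bsub>k\<^esub>\<close> tends to 0, so every cluster point is a fixed
  point and therefore the limit.

  For the rank, \<open>G\<^bsub>k\<^esub> = (Z\<^bsub>k\<^esub> - R\<^bsub>k+1\<^esub>) / (\<tau>\<gamma>)\<close> is a subgradient of the nuclear norm at \<open>R\<^bsub>k+1\<^esub>\<close>, so it has
  operator norm at most 1 and is isometric on a subspace of dimension at least \<open>rank R\<^bsub>k+1\<^esub>\<close>. The limit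
  of the \<open>G\<^bsub>k\<^esub>\<close> lies in the relative interior of the subdifferential at \<open>X\<^sup>\<star>\<close>, which forces it to be
  strictly contractive on the kernel of \<open>X\<^sup>\<star>\<close>. By compactness so is \<open>G\<^bsub>k\<^esub>\<close> for large \<open>k\<close>; then \<open>X\<^sup>\<star>\<close> is
  injective on the isometry subspace of \<open>G\<^bsub>k\<^esub>\<close> and \<open>rank R\<^bsub>k+1\<^esub> \<le> rank X\<^sup>\<star>\<close>. The reverse inequality is
  lower semicontinuity of the rank.
\<close>

subsection \<open>Duality between the nuclear and the operator norm\<close>

text \<open>First-order condition for a minimum over all of R: near 0 the linear term dominates and
  changes sign with \<open>t\<close>. It turns extremality of a quadratic form into orthogonality
  relations.\<close>

lemma linear_coeff_zero_of_quadratic_nonneg: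
  fixes b c :: real
  assumes "\<And>t. 0 \<le> 2 * t * b + t\<^sup>2 * c"
  shows "b = 0"
proof (rule ccontr)
  assume b: "b \<noteq> 0"
  \<comment> \<open>Dividing by a \<open>K\<close> larger than \<open>c\<close> makes
    \<open>t = - b / K\<close> so small that the quadratic term cannot compensate the linear
    one.\<close>
  define K where "K = \<bar>c\<bar> + 1"
  have K: "K > 0" "c < K" by (auto simp: K_def)
  have "0 \<le> 2 * (- b / K) * b + (- b / K)\<^sup>2 * c" by (rule assms)
  also have "\<dots> = (c / K - 2) * (b\<^sup>2 / K)"
    using K by (simp add: field_simps power2_eq_square)
  finally have "0 \<le> (c / K - 2) * (b\<^sup>2 / K)" .
  moreover have "0 < b\<^sup>2 / K" using b K by simp
  ultimately have "0 \<le> c / K - 2" by (simp only: zero_le_mult_iff) linarith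
  moreover have "c / K < 1" using K by simp
  ultimately show False by simp
qed

lemma continuous_on_norm_mult: "continuous_on S (\<lambda>x. norm (A *v x))"
  for A :: "real ^ 'n ^ 'm"
  by (intro continuous_on_norm linear_continuous_on matrix_vector_mul_bounded_linear)

lemma inner_matrix_vector_transpose: "(A *v x) \<bullet> y = x \<bullet> (transpose A *v y)"
  for A :: "real ^ 'n ^ 'm"
  by (metis dot_lmul_matrix transpose_matrix_vector inner_commute)

lemma inner_gram: "x \<bullet> ((transpose A ** A) *v y) = (A *v x) \<bullet> (A *v y)"
  for A :: "real ^ 'n ^ 'm"
  by (simp add: inner_matrix_vector_transpose matrix_vector_mul_assoc)

lemma norm_singular_vector:
  assumes "v \<in> singular_space A s" "0 \<le> s"
  shows "norm (A *v v) = s * norm v"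
proof -
  have "(norm (A *v v))\<^sup>2 = (s * norm v)\<^sup>2"
    using assms(1) inner_gram[of v A v]
    by (simp add: singular_space_def power2_norm_eq_inner power_mult_distrib)
  then show ?thesis using assms(2) by (simp add: power2_eq_iff_nonneg)
qed

lemma orthogonal_singular_vectors:
  assumes "v \<in> singular_space A s" "w \<in> singular_space A t" "0 \<le> s" "0 \<le> t" "s \<noteq> t"
  shows "v \<bullet> w = 0"
proof -
  have "s\<^sup>2 * (v \<bullet> w) = t\<^sup>2 * (v \<bullet> w)"
    using assms(1,2) inner_gram[of v A w] inner_gram[of w A v]
    by (simp add: singular_space_def inner_commute)
  moreover have "s\<^sup>2 \<noteq> t\<^sup>2" using assms by (simp add: power2_eq_iff_nonneg)
  ultimately show ?thesis by simp
qed

lemma subspace_singular_space: "subspace (singular_space A s)"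
  by (simp add: singular_space_def subspace_def algebra_simps matrix_vector_mult_scaleR)

text \<open>
  Otherwise a maximiser of the Rayleigh quotient on the orthogonal complement of \<open>span B\<close> would be
  another right singular vector.
\<close>

lemma right_singular_vectors_total:
  fixes A :: "real ^ 'n ^ 'm"
  assumes "\<And>s. s \<in> singular_values A \<Longrightarrow> singular_space A s \<subseteq> span B"
    and "B \<subseteq> (\<Union>s \<in> singular_values A. singular_space A s)"
  shows "span B = UNIV"
proof (rule ccontr)
  assume "span B \<noteq> UNIV"
  then have "span B \<subset> UNIV" by auto
  then obtain x where x: "x \<noteq> 0" "\<And>y. y \<in> span B \<Longrightarrow> orthogonal x y"
    using orthogonal_to_subspace_exists_gen[of B UNIV] by auto
  \<comment> \<open>The orthogonal complement of \<open>B\<close>, on whose unit sphere the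
    maximiser \<open>w\<close> is sought.\<close>
  define P where "P = {x. \<forall>v\<in>B. v \<bullet> x = 0}"
  have P_scale: "c *\<^sub>R u \<in> P" and P_add: "u + u' \<in> P" if "u \<in> P" "u' \<in> P" for c u u'
    using that by (auto simp: P_def inner_add_right)
  have "P = (\<Inter>v\<in>B. {x. v \<bullet> x = 0})" by (auto simp: P_def)
  then have "closed P" by (auto intro: closed_hyperplane)
  then have "compact (P \<inter> sphere 0 1)" by (simp add: closed_Int_compact)
  moreover have xP: "x \<in> P"
    using x by (auto simp: P_def orthogonal_def inner_commute span_base)
  then have "P \<inter> sphere 0 1 \<noteq> {}"
    using x(1) P_scale[OF xP xP, of "1 / norm x"] by (auto intro!: exI[of _ "(1 / norm x) *\<^sub>R x"])
  ultimately have "\<exists>w\<in>P \<inter> sphere 0 1. \<forall>y\<in>P \<inter> sphere 0 1. norm (A *v y) \<le> norm (A *v w)"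
    by (rule continuous_attains_sup[OF _ _ continuous_on_norm_mult])
  then obtain w where w: "w \<in> P" "norm w = 1"
      "\<And>y. y \<in> P \<Longrightarrow> norm y = 1 \<Longrightarrow> norm (A *v y) \<le> norm (A *v w)"
    by auto
  define \<sigma> where "\<sigma> = norm (A *v w)"
  have max: "norm (A *v y) \<le> \<sigma> * norm y" if "y \<in> P" for y
  proof (cases "y = 0")
    case False
    have "norm (A *v ((1 / norm y) *\<^sub>R y)) \<le> \<sigma>"
      unfolding \<sigma>_def using False that P_scale by (intro w) auto
    then show ?thesis using False by (simp add: matrix_vector_mult_scaleR field_simps)
  qed simp
  \<comment> \<open>The form \<sigma>^2 |y|^2 - |A y|^2 is nonnegative on \<open>P\<close> and
    vanishes at \<open>w\<close>, so its derivative at \<open>w\<close> vanishes in every direction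
    of \<open>P\<close>.\<close>
  have crit: "\<sigma>\<^sup>2 * (w \<bullet> y) - (A *v w) \<bullet> (A *v y) = 0" if y: "y \<in> P" for y
  proof (rule linear_coeff_zero_of_quadratic_nonneg)
    fix t :: real
    have "w + t *\<^sub>R y \<in> P" using w y P_add P_scale by auto
    then have "(norm (A *v (w + t *\<^sub>R y)))\<^sup>2 \<le> (\<sigma> * norm (w + t *\<^sub>R y))\<^sup>2"
      using max by (intro power_mono) auto
    then show "0 \<le> 2 * t * (\<sigma>\<^sup>2 * (w \<bullet> y) - (A *v w) \<bullet> (A *v y))
                 + t\<^sup>2 * (\<sigma>\<^sup>2 * (norm y)\<^sup>2 - (norm (A *v y))\<^sup>2)"
      using w(2)
      by (simp add: power_mult_distrib power2_norm_eq_inner algebra_simps matrix_vector_mult_scaleR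
          inner_commute \<sigma>_def power2_eq_square[of t] norm_eq_1)
  qed
  \<comment> \<open>The residual of the eigenvector equation. It lies in \<open>P\<close> and, by
    \<open>crit\<close>, is orthogonal to \<open>P\<close>, hence it is zero.\<close>
  define z where "z = (transpose A ** A) *v w - \<sigma>\<^sup>2 *\<^sub>R w"
  have z: "z \<bullet> y = (A *v w) \<bullet> (A *v y) - \<sigma>\<^sup>2 * (w \<bullet> y)" for y
    using inner_gram[of y A w]
    by (simp add: z_def inner_diff_right inner_commute[of _ y] inner_commute[of "A *v y"])
  have "z \<in> P"
    unfolding P_def
  proof safe
    fix v assume v: "v \<in> B"
    then obtain s where "v \<in> singular_space A s" using assms(2) by auto
    then have "w \<bullet> ((transpose A ** A) *v v) = s\<^sup>2 * (w \<bullet> v)" by (simp add: singular_space_def)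
    moreover have "w \<bullet> v = 0" using w(1) v by (simp add: P_def inner_commute)
    ultimately show "v \<bullet> z = 0" using z[of v] inner_gram[of w A v] by (simp add: inner_commute)
  qed
  then have "z \<bullet> z = 0" using z[of z] crit[of z] by simp
  then have "w \<in> singular_space A \<sigma>" by (simp add: singular_space_def z_def)
  moreover from this have "\<sigma> \<in> singular_values A"
    using w(2) by (auto simp: singular_values_def \<sigma>_def intro!: bexI[of _ w])
  ultimately have "w \<in> span B" using assms(1) by auto
  moreover have "orthogonal w v" if "v \<in> B" for v
    using that w(1) by (simp add: P_def orthogonal_def inner_commute)
  ultimately have "orthogonal w w" using orthogonal_to_span by blast
  then show False using w(2) by (simp add: orthogonal_def)
qed

text \<open>The half of the singular value decomposition that the proof needs. Orthonormal bases of
  the singular spaces are glued together; the space for the singular value 0 contributes a basis of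
  the kernel. Images of distinct basis vectors stay orthogonal because the basis consists of
  eigenvectors of A^T A.\<close>

lemma right_singular_basis:
  fixes A :: "real ^ 'n ^ 'm"
  obtains B where "finite B" "pairwise orthogonal B" "\<And>v. v \<in> B \<Longrightarrow> norm v = 1" "span B = UNIV"
    "\<And>v w. v \<in> B \<Longrightarrow> w \<in> B \<Longrightarrow> v \<noteq> w \<Longrightarrow> (A *v v) \<bullet> (A *v w) = 0"
    "nuclear_norm A = (\<Sum>v\<in>B. norm (A *v v))"
proof -
  let ?S = "singular_values A"
  have "\<forall>s. \<exists>b. b \<subseteq> singular_space A s \<and> pairwise orthogonal b \<and> (\<forall>x\<in>b. norm x = 1) \<and>
      independent b \<and> card b = dim (singular_space A s) \<and> span b = singular_space A s"
    by (metis orthonormal_basis_subspace[OF subspace_singular_space])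
  then obtain b where b: "\<And>s. b s \<subseteq> singular_space A s" "\<And>s. pairwise orthogonal (b s)"
      "\<And>s x. x \<in> b s \<Longrightarrow> norm x = 1" "\<And>s. independent (b s)"
      "\<And>s. card (b s) = dim (singular_space A s)" "\<And>s. span (b s) = singular_space A s"
    by metis
  define B where "B = (\<Union>s\<in>?S. b s)"
  have pos: "0 \<le> s" if "s \<in> ?S" for s using that by (simp add: singular_values_def)
  have orth: "v \<bullet> w = 0" if "v \<in> b s" "w \<in> b t" "s \<in> ?S" "t \<in> ?S" "v \<noteq> w" for v w s t
  proof (cases "s = t")
    case True
    then show ?thesis using b(2)[of s] that by (auto simp: pairwise_def orthogonal_def)
  next
    case False
    then show ?thesis
      using orthogonal_singular_vectors[of v A s w t] that b(1) pos by blast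
  qed
  have disj: "b s \<inter> b t = {}" if "s \<in> ?S" "t \<in> ?S" "s \<noteq> t" for s t
  proof -
    have "v \<notin> b t" if "v \<in> b s" for v
    proof
      assume "v \<in> b t"
      then have "v \<bullet> v = 0"
        using orthogonal_singular_vectors[of v A s v t] \<open>s \<in> ?S\<close> \<open>t \<in> ?S\<close> \<open>s \<noteq> t\<close> that b(1) pos
        by blast
      then show False using b(3)[OF that] by simp
    qed
    then show ?thesis by auto
  qed
  have fin: "finite (b s)" for s using b(4) independent_imp_finite by blast
  show thesis
  proof
    show "finite B" unfolding B_def using fin finite_singular_values by blast
    show "pairwise orthogonal B"
      using orth by (auto simp: B_def pairwise_def orthogonal_def)
    show "\<And>v. v \<in> B \<Longrightarrow> norm v = 1" using b(3) by (auto simp: B_def)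
    show "span B = UNIV"
    proof (rule right_singular_vectors_total)
      show "singular_space A s \<subseteq> span B" if "s \<in> ?S" for s
        using b(6)[of s] span_mono[of "b s" B] that by (auto simp: B_def)
      show "B \<subseteq> (\<Union>s\<in>?S. singular_space A s)" using b(1) by (auto simp: B_def)
    qed
    show "(A *v v) \<bullet> (A *v w) = 0" if vw: "v \<in> B" "w \<in> B" "v \<noteq> w" for v w
    proof -
      obtain s t where st: "s \<in> ?S" "t \<in> ?S" "v \<in> b s" "w \<in> b t" using vw by (auto simp: B_def)
      have "(A *v v) \<bullet> (A *v w) = t\<^sup>2 * (v \<bullet> w)"
        using b(1)[of t] st by (auto simp: inner_gram[symmetric] singular_space_def)
      then show ?thesis using orth[OF st(3,4,1,2) vw(3)] by simp
    qed
    have "(\<Sum>v\<in>B. norm (A *v v)) = (\<Sum>s\<in>?S. \<Sum>v\<in>b s. norm (A *v v))"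
      unfolding B_def using disj fin by (intro sum.UNION_disjoint finite_singular_values) auto
    also have "\<dots> = (\<Sum>s\<in>?S. real (dim (singular_space A s)) * s)"
    proof (rule sum.cong)
      fix s assume s: "s \<in> ?S"
      have "norm (A *v v) = s" if "v \<in> b s" for v
        using norm_singular_vector[of v A s] that b(1,3) pos s by auto
      then show "(\<Sum>v\<in>b s. norm (A *v v)) = real (dim (singular_space A s)) * s"
        by (simp add: b(5))
    qed simp
    finally show "nuclear_norm A = (\<Sum>v\<in>B. norm (A *v v))" by (simp add: nuclear_norm_def)
  qed
qed

lemma inner_orthonormal_basis:
  fixes x y :: "'a::euclidean_space"
  assumes "finite B" "pairwise orthogonal B" "\<And>v. v \<in> B \<Longrightarrow> norm v = 1" "span B = UNIV"
  shows "x \<bullet> y = (\<Sum>v\<in>B. (x \<bullet> v) * (y \<bullet> v))"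
proof -
  have "(\<Sum>v\<in>B. (x \<bullet> v) *\<^sub>R v) = x"
    using assms by (intro orthonormal_basis_expand) auto
  then have "x \<bullet> y = (\<Sum>v\<in>B. (x \<bullet> v) *\<^sub>R v) \<bullet> y" by simp
  also have "\<dots> = (\<Sum>v\<in>B. (x \<bullet> v) * (y \<bullet> v))"
    unfolding inner_sum_left by (simp add: inner_commute)
  finally show ?thesis .
qed

text \<open>The trace of G^T A may be computed in any orthonormal basis: Parseval is applied to each
  pair of rows.\<close>

lemma matrix_inner_orthonormal_basis:
  fixes G A :: "real ^ 'n ^ 'm"
  assumes "finite B" "pairwise orthogonal B" "\<And>v. v \<in> B \<Longrightarrow> norm v = 1" "span B = UNIV"
  shows "G \<bullet> A = (\<Sum>v\<in>B. (G *v v) \<bullet> (A *v v))"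
proof -
  have "G \<bullet> A = (\<Sum>i\<in>UNIV. \<Sum>v\<in>B. (G $ i \<bullet> v) * (A $ i \<bullet> v))"
    unfolding inner_vec_def[of G A] by (intro sum.cong refl inner_orthonormal_basis assms)
  also have "\<dots> = (\<Sum>v\<in>B. \<Sum>i\<in>UNIV. (G $ i \<bullet> v) * (A $ i \<bullet> v))"
    by (rule sum.swap)
  finally show ?thesis
    by (simp add: inner_vec_def[of "_ *v _"] matrix_vector_mul_component)
qed

text \<open>The unit ball of the operator norm, which is the dual ball of the nuclear norm.\<close>

definition contraction :: "real ^ 'n ^ 'm \<Rightarrow> bool"
  where "contraction G \<longleftrightarrow> (\<forall>x. norm (G *v x) \<le> norm x)"

text \<open>In a right singular basis of \<open>A\<close> the trace splits into terms that
  Cauchy-Schwarz bounds by the singular values.\<close>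

lemma nuclear_norm_ge_inner:
  assumes "contraction G"
  shows "G \<bullet> A \<le> nuclear_norm A"
proof -
  obtain B where B: "finite B" "pairwise orthogonal B" "\<And>v. v \<in> B \<Longrightarrow> norm v = 1" "span B = UNIV"
    "nuclear_norm A = (\<Sum>v\<in>B. norm (A *v v))"
    using right_singular_basis[of A] by metis
  have "(G *v v) \<bullet> (A *v v) \<le> norm (A *v v)" if "v \<in> B" for v
  proof -
    have "(G *v v) \<bullet> (A *v v) \<le> norm (G *v v) * norm (A *v v)" by (rule norm_cauchy_schwarz)
    also have "\<dots> \<le> 1 * norm (A *v v)"
      using assms[unfolded contraction_def, rule_format, of v] B(3)[OF that]
      by (intro mult_right_mono) auto
    finally show ?thesis by simp
  qed
  then have "(\<Sum>v\<in>B. (G *v v) \<bullet> (A *v v)) \<le> nuclear_norm A"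
    unfolding B(5) by (rule sum_mono)
  then show ?thesis using matrix_inner_orthonormal_basis[OF B(1-4), of G A] by simp
qed

definition outer :: "real ^ 'm \<Rightarrow> real ^ 'n \<Rightarrow> real ^ 'n ^ 'm"
  where "outer u v = (\<chi> i j. u $ i * v $ j)"

lemma outer_mult_vec: "outer u v *v x = (v \<bullet> x) *\<^sub>R u"
  by (simp add: outer_def vec_eq_iff matrix_vector_mult_def inner_vec_def sum_distrib_left mult_ac)

lemma inner_outer: "outer u v \<bullet> G = u \<bullet> (G *v v)"
  by (simp add: outer_def matrix_vector_mult_def inner_vec_def sum_distrib_left mult_ac)

lemma sum_matrix_vector_mult: "(\<Sum>i\<in>S. M i) *v x = (\<Sum>i\<in>S. M i *v x)"
  for M :: "'i \<Rightarrow> real ^ 'n ^ 'm"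
  by (induction S rule: infinite_finite_induct) (auto simp: matrix_vector_mult_add_rdistrib)

lemma inner_sgn_self: "sgn x \<bullet> x = norm x" for x :: "'a::real_inner"
  by (cases "x = 0")
    (simp_all add: sgn_div_norm power2_norm_eq_inner[symmetric] power2_eq_square)

text \<open>The maximiser is the polar factor of \<open>A\<close>, sending each right singular
  vector to the corresponding left one. It is a contraction by Pythagoras, as the left singular
  vectors are pairwise orthogonal.\<close>

lemma nuclear_norm_attained:
  fixes A :: "real ^ 'n ^ 'm"
  obtains G where "contraction G" "G \<bullet> A = nuclear_norm A"
proof -
  obtain B where B: "finite B" "pairwise orthogonal B" "\<And>v. v \<in> B \<Longrightarrow> norm v = 1" "span B = UNIV"
    and orth: "\<And>v w. v \<in> B \<Longrightarrow> w \<in> B \<Longrightarrow> v \<noteq> w \<Longrightarrow> (A *v v) \<bullet> (A *v w) = 0"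
    and nn: "nuclear_norm A = (\<Sum>v\<in>B. norm (A *v v))"
    using right_singular_basis[of A] by metis
  \<comment> \<open>Since \<open>sgn 0 = 0\<close>, kernel vectors of \<open>A\<close> are sent to 0
    without a case distinction.\<close>
  define G where "G = (\<Sum>v\<in>B. outer (sgn (A *v v)) v)"
  have Gx: "G *v x = (\<Sum>v\<in>B. (v \<bullet> x) *\<^sub>R sgn (A *v v))" for x
    by (simp add: G_def sum_matrix_vector_mult outer_mult_vec)
  have "contraction G"
    unfolding contraction_def
  proof
    fix x
    have "(norm (G *v x))\<^sup>2 = (\<Sum>v\<in>B. (norm ((v \<bullet> x) *\<^sub>R sgn (A *v v)))\<^sup>2)"
      unfolding Gx using B(1) orth
      by (intro norm_sum_Pythagorean) (auto simp: pairwise_def orthogonal_def sgn_div_norm)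
    also have "\<dots> \<le> (\<Sum>v\<in>B. (x \<bullet> v) * (x \<bullet> v))"
      by (intro sum_mono) (auto simp: norm_sgn inner_commute power2_eq_square)
    also have "\<dots> = (norm x)\<^sup>2"
      unfolding power2_norm_eq_inner by (rule inner_orthonormal_basis[OF B, symmetric])
    finally show "norm (G *v x) \<le> norm x" by (simp add: power2_le_iff_abs_le)
  qed
  moreover have "G \<bullet> A = (\<Sum>v\<in>B. sgn (A *v v) \<bullet> (A *v v))"
    by (simp add: G_def inner_sum_left inner_outer)
  then have "G \<bullet> A = nuclear_norm A"
    unfolding nn by (simp add: inner_sgn_self)
  ultimately show thesis using that by blast
qed

lemma norm_matrix_vector_mult_le: "norm (A *v x) \<le> norm A * norm x"
  for A :: "real ^ 'n ^ 'm"
proof -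
  have "(norm (A *v x))\<^sup>2 = (\<Sum>i\<in>UNIV. (A $ i \<bullet> x)\<^sup>2)"
    unfolding power2_norm_eq_inner inner_vec_def[of "A *v x"]
    by (simp add: matrix_vector_mul_component power2_eq_square)
  also have "\<dots> \<le> (\<Sum>i\<in>UNIV. (A $ i \<bullet> A $ i) * (x \<bullet> x))"
    by (intro sum_mono Cauchy_Schwarz_ineq)
  also have "\<dots> = (norm A * norm x)\<^sup>2"
    by (simp add: power_mult_distrib power2_norm_eq_inner inner_vec_def[of A] sum_distrib_right)
  finally show ?thesis by (rule power2_le_imp_le) simp
qed

text \<open>The operator norm is at most the Frobenius norm, so the normalised matrix is an
  admissible dual element. This supplies the coercivity of the regularised objective.\<close>

lemma norm_le_nuclear_norm: "norm A \<le> nuclear_norm A"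
proof -
  have "contraction (sgn A)"
    using norm_matrix_vector_mult_le[of A]
    by (cases "A = 0") (auto simp: contraction_def sgn_div_norm scaleR_matrix_vector_assoc[symmetric]
        field_simps)
  then have "sgn A \<bullet> A \<le> nuclear_norm A" by (rule nuclear_norm_ge_inner)
  then show ?thesis by (simp add: inner_sgn_self)
qed

lemma nuclear_norm_nonneg: "0 \<le> nuclear_norm A"
  using norm_le_nuclear_norm[of A] norm_ge_zero order_trans by blast

text \<open>By duality the nuclear norm is a supremum of linear functionals; the one attaining it at
  the convex combination is tested at both end points.\<close>

lemma convex_on_nuclear_norm: "convex_on UNIV nuclear_norm"
proof (rule convex_onI)
  fix t :: real and A B :: "real ^ 'n ^ 'm"
  assume t: "0 < t" "t < 1"
  obtain G where G: "contraction G"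
      "G \<bullet> ((1 - t) *\<^sub>R A + t *\<^sub>R B) = nuclear_norm ((1 - t) *\<^sub>R A + t *\<^sub>R B)"
    using nuclear_norm_attained by blast
  have "(1 - t) * (G \<bullet> A) + t * (G \<bullet> B) \<le> (1 - t) * nuclear_norm A + t * nuclear_norm B"
    using t nuclear_norm_ge_inner[OF G(1)] by (intro add_mono mult_left_mono) auto
  then show "nuclear_norm ((1 - t) *\<^sub>R A + t *\<^sub>R B) \<le> (1 - t) * nuclear_norm A + t * nuclear_norm B"
    by (simp add: G(2)[symmetric] inner_add_right)
qed simp

lemma continuous_on_nuclear_norm: "continuous_on UNIV nuclear_norm"
  by (rule convex_on_continuous[OF open_UNIV convex_on_nuclear_norm])

lemma nuclear_norm_zero [simp]: "nuclear_norm 0 = 0"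
  using nuclear_norm_attained[of 0] by (metis inner_zero_right)

lemma subdifferential_nuclear_norm_iff:
  fixes X G :: "real ^ 'n ^ 'm"
  shows "G \<in> subdifferential nuclear_norm X \<longleftrightarrow> contraction G \<and> G \<bullet> X = nuclear_norm X"
proof
  assume "G \<in> subdifferential nuclear_norm X"
  then have G: "nuclear_norm X + G \<bullet> (Y - X) \<le> nuclear_norm Y" for Y
    by (simp add: subdifferential_def)
  have "norm (G *v x) \<le> norm x" for x
  proof -
    \<comment> \<open>Moving from \<open>X\<close> in this rank-one direction raises the linear
      model by |G x|^2, while the nuclear norm grows by at most |G x| |x|.\<close>
    define M where "M = outer (G *v x) x"
    obtain H where H: "contraction H" "H \<bullet> (X + M) = nuclear_norm (X + M)"
      using nuclear_norm_attained by blast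
    have "nuclear_norm X + G \<bullet> M \<le> nuclear_norm (X + M)" using G[of "X + M"] by simp
    then have "M \<bullet> G \<le> M \<bullet> H"
      using H(2) nuclear_norm_ge_inner[OF H(1), of X]
      by (simp add: inner_add_right inner_commute[of M])
    then have "norm (G *v x) * norm (G *v x) \<le> (G *v x) \<bullet> (H *v x)"
      by (simp add: M_def inner_outer power2_norm_eq_inner flip: power2_eq_square)
    also have "\<dots> \<le> norm (G *v x) * norm x"
      using norm_cauchy_schwarz[of "G *v x" "H *v x"] H(1)
      by (meson contraction_def mult_left_mono norm_ge_zero order_trans)
    finally show ?thesis by (cases "G *v x = 0") auto
  qed
  then have "contraction G" by (simp add: contraction_def)
  moreover have "nuclear_norm X \<le> G \<bullet> X" using G[of 0] by simp
  ultimately show "contraction G \<and> G \<bullet> X = nuclear_norm X"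
    using nuclear_norm_ge_inner[of G X] by simp
next
  assume "contraction G \<and> G \<bullet> X = nuclear_norm X"
  then show "G \<in> subdifferential nuclear_norm X"
    using nuclear_norm_ge_inner[of G] by (simp add: subdifferential_def inner_diff_right)
qed

subsection \<open>Subgradients of the nuclear norm and the rank\<close>

text \<open>The kernel of I - G^T G. The polarised form makes it a subspace for every
  \<open>G\<close>; for a contraction it is exactly the set of vectors whose length is
  preserved.\<close>

definition isometry_space :: "real ^ 'n ^ 'm \<Rightarrow> (real ^ 'n) set"
  where "isometry_space G = {v. \<forall>w. (G *v v) \<bullet> (G *v w) = v \<bullet> w}"

lemma subspace_isometry_space: "subspace (isometry_space G)"
  by (auto simp: isometry_space_def subspace_def matrix_vector_right_distrib
      matrix_vector_mult_scaleR inner_add_left)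

text \<open>For a contraction, |x|^2 - |G x|^2 is a positive semidefinite form, and a vector at
  which such a form vanishes lies in its radical.\<close>

lemma isometry_spaceI:
  assumes "contraction G" "norm (G *v v) = norm v"
  shows "v \<in> isometry_space G"
  unfolding isometry_space_def
proof safe
  fix w
  have "v \<bullet> w - (G *v v) \<bullet> (G *v w) = 0"
  proof (rule linear_coeff_zero_of_quadratic_nonneg)
    fix t :: real
    have "(norm (G *v (v + t *\<^sub>R w)))\<^sup>2 \<le> (norm (v + t *\<^sub>R w))\<^sup>2"
      using assms(1) by (intro power_mono) (auto simp: contraction_def)
    moreover have "(G *v v) \<bullet> (G *v v) = v \<bullet> v"
      using assms(2) by (simp flip: power2_norm_eq_inner)
    ultimately show "0 \<le> 2 * t * (v \<bullet> w - (G *v v) \<bullet> (G *v w))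
        + t\<^sup>2 * ((norm w)\<^sup>2 - (norm (G *v w))\<^sup>2)"
      by (simp add: power2_norm_eq_inner algebra_simps matrix_vector_mult_scaleR
          inner_commute power2_eq_square[of t])
  qed
  then show "(G *v v) \<bullet> (G *v w) = v \<bullet> w" by simp
qed

lemma norm_isometry_space: "v \<in> isometry_space G \<Longrightarrow> norm (G *v v) = norm v"
  by (simp add: isometry_space_def norm_eq)

text \<open>Equality in the trace duality forces equality in every term of the Cauchy-Schwarz
  estimate. Thus \<open>G\<close> preserves the length of each right singular vector with nonzero
  singular value, and the images of those vectors span the range of \<open>X\<close>.\<close>

lemma rank_le_dim_isometry_space:
  fixes X :: "real ^ 'n ^ 'm"
  assumes "G \<in> subdifferential nuclear_norm X"
  shows "rank X \<le> dim (isometry_space G)"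
proof -
  have G: "contraction G" "G \<bullet> X = nuclear_norm X"
    using assms by (auto simp: subdifferential_nuclear_norm_iff)
  obtain B where B: "finite B" "pairwise orthogonal B" "\<And>v. v \<in> B \<Longrightarrow> norm v = 1" "span B = UNIV"
    "nuclear_norm X = (\<Sum>v\<in>B. norm (X *v v))"
    using right_singular_basis[of X] by metis
  define C where "C = {v\<in>B. X *v v \<noteq> 0}"
  have cs: "(G *v v) \<bullet> (X *v v) \<le> norm (G *v v) * norm (X *v v)"
    "norm (G *v v) \<le> 1" if "v \<in> B" for v
    using norm_cauchy_schwarz[of "G *v v" "X *v v"] G(1)[unfolded contraction_def, rule_format, of v]
      B(3)[OF that] by auto
  have le: "(G *v v) \<bullet> (X *v v) \<le> norm (X *v v)" if "v \<in> B" for v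
    using cs[OF that] by (meson mult_left_le_one_le norm_ge_zero order_trans)
  have "(\<Sum>v\<in>B. norm (X *v v) - (G *v v) \<bullet> (X *v v)) = 0"
    using G(2) B(5) matrix_inner_orthonormal_basis[OF B(1-4), of G X] by (simp add: sum_subtractf)
  then have eq: "(G *v v) \<bullet> (X *v v) = norm (X *v v)" if "v \<in> B" for v
    using sum_nonneg_eq_0_iff[OF B(1), of "\<lambda>v. norm (X *v v) - (G *v v) \<bullet> (X *v v)"] le that
    by simp
  have "C \<subseteq> isometry_space G"
  proof
    fix v assume "v \<in> C"
    then have v: "v \<in> B" "X *v v \<noteq> 0" by (auto simp: C_def)
    have "1 * norm (X *v v) \<le> norm (G *v v) * norm (X *v v)" using cs(1) eq v by simp
    then have "1 \<le> norm (G *v v)" using v(2) by (simp only: mult_le_cancel_right) auto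
    then have "norm (G *v v) = norm v" using cs(2) B(3) v(1) by force
    then show "v \<in> isometry_space G" using G(1) by (rule isometry_spaceI[rotated])
  qed
  then have "card C \<le> dim (isometry_space G)"
  proof (rule independent_card_le_dim)
    show "independent C"
      using B(2,3) by (intro pairwise_orthogonal_independent)
        (auto simp: C_def intro: pairwise_subset)
  qed
  moreover have "rank X \<le> card C"
  proof -
    have "range ((*v) X) = span ((*v) X ` B)"
      using B(4) by (metis linear_span_image matrix_vector_mul_linear)
    also have "\<dots> \<subseteq> span ((*v) X ` C)"
    proof (rule span_minimal)
      show "(*v) X ` B \<subseteq> span ((*v) X ` C)"
      proof
        fix u assume "u \<in> (*v) X ` B"
        then show "u \<in> span ((*v) X ` C)"
          by (cases "u = 0") (auto simp: C_def span_zero intro!: span_base)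
      qed
    qed simp
    finally have "rank X \<le> card ((*v) X ` C)"
      unfolding rank_dim_range using B(1) by (intro span_card_ge_dim) (auto simp: C_def)
    also have "\<dots> \<le> card C" using B(1) by (intro card_image_le) (simp add: C_def)
    finally show ?thesis .
  qed
  ultimately show ?thesis by simp
qed

lemma convex_subdifferential: "convex (subdifferential h x)"
proof (rule convexI)
  fix g g' and s t :: real
  assume g: "g \<in> subdifferential h x" "g' \<in> subdifferential h x" and st: "0 \<le> s" "0 \<le> t" "s + t = 1"
  have "h x + (s *\<^sub>R g + t *\<^sub>R g') \<bullet> (y - x) \<le> h y" for y
  proof -
    have "s * (h x + g \<bullet> (y - x)) + t * (h x + g' \<bullet> (y - x)) \<le> s * h y + t * h y"
      using g st by (intro add_mono mult_left_mono) (auto simp: subdifferential_def)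
    moreover have "s * h x + t * h x = h x" "s * h y + t * h y = h y"
      using st(3) by (simp_all flip: distrib_right)
    ultimately show ?thesis by (simp add: algebra_simps)
  qed
  then show "s *\<^sub>R g + t *\<^sub>R g' \<in> subdifferential h x" by (simp add: subdifferential_def)
qed

text \<open>
  If \<open>G\<close> maps a unit vector \<open>v\<close> of the kernel of \<open>X\<close> isometrically to \<open>u\<close>, then \<open>G - u v\<^sup>T\<close> is another
  subgradient, but no point \<open>G + \<epsilon> u v\<^sup>T\<close> beyond \<open>G\<close> is one.
\<close>

lemma rel_interior_subdifferential_nuclear_norm:
  fixes X :: "real ^ 'n ^ 'm"
  assumes "G \<in> rel_interior (subdifferential nuclear_norm X)" and "X *v v = 0"
    and "norm (G *v v) = norm v"
  shows "v = 0"
proof (rule ccontr)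
  assume "v \<noteq> 0"
  define w where "w = sgn v"
  have w: "norm w = 1" "X *v w = 0" "norm (G *v w) = 1"
    using \<open>v \<noteq> 0\<close> assms(2,3)
    by (auto simp: w_def norm_sgn sgn_div_norm matrix_vector_mult_scaleR)
  define H where "H = G - outer (G *v w) w"
  have GS: "G \<in> subdifferential nuclear_norm X"
    using assms(1) rel_interior_subset by blast
  then have G: "contraction G" "G \<bullet> X = nuclear_norm X"
    by (auto simp: subdifferential_nuclear_norm_iff)
  have iso: "w \<in> isometry_space G" using G w by (intro isometry_spaceI) auto
  have Hx: "H *v x = G *v (x - (w \<bullet> x) *\<^sub>R w)" for x
    by (simp add: H_def matrix_vector_mult_diff_rdistrib matrix_vector_mult_diff_distrib
        outer_mult_vec matrix_vector_mult_scaleR)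
  have "contraction H"
    unfolding contraction_def
  proof
    fix x
    have "w \<bullet> w = 1" using w(1) by (simp add: norm_eq_1)
    then have "(norm (x - (w \<bullet> x) *\<^sub>R w))\<^sup>2 = (norm x)\<^sup>2 - (w \<bullet> x)\<^sup>2"
      unfolding power2_norm_eq_inner
      by (simp add: inner_diff_left inner_diff_right inner_commute[of x w] power2_eq_square)
    then have "(norm (x - (w \<bullet> x) *\<^sub>R w))\<^sup>2 \<le> (norm x)\<^sup>2" by simp
    then have "norm (x - (w \<bullet> x) *\<^sub>R w) \<le> norm x" by (rule power2_le_imp_le) simp
    then show "norm (H *v x) \<le> norm x"
      unfolding Hx using G(1) by (meson contraction_def order_trans)
  qed
  moreover have "H \<bullet> X = nuclear_norm X"
    using w(2) G(2) by (simp add: H_def inner_diff_left inner_outer)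
  ultimately have "H \<in> subdifferential nuclear_norm X"
    by (simp add: subdifferential_nuclear_norm_iff)
  then obtain c where c: "c > 1" "(1 - c) *\<^sub>R H + c *\<^sub>R G \<in> subdifferential nuclear_norm X"
    using convex_rel_interior_if2[OF convex_subdifferential assms(1)] hull_inc by metis
  \<comment> \<open>The prolonged point is G + (c - 1) u w^T with u = G w; it stretches the unit
    vector \<open>w\<close> to length \<open>c > 1\<close>, so it is no contraction.\<close>
  have "((1 - c) *\<^sub>R H + c *\<^sub>R G) *v w = c *\<^sub>R (G *v w)"
    using w(1) by (simp add: matrix_vector_mult_add_rdistrib scaleR_matrix_vector_assoc[symmetric]
        Hx norm_eq_1)
  moreover have "norm (((1 - c) *\<^sub>R H + c *\<^sub>R G) *v w) \<le> 1"
    using c(2)[unfolded subdifferential_nuclear_norm_iff contraction_def, THEN conjunct1,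
        rule_format, of w] w(1) by simp
  ultimately show False using c(1) w(3) by simp
qed

section \<open>Behaviour of the rank under perturbation\<close>

lemma dim_le_rank_of_injective:
  fixes A :: "real ^ 'n ^ 'm"
  assumes "subspace S" "\<And>x. x \<in> S \<Longrightarrow> A *v x = 0 \<Longrightarrow> x = 0"
  shows "dim S \<le> rank A"
proof -
  have "inj_on ((*v) A) S"
    using assms by (auto simp: linear_injective_on_subspace_0)
  then have "dim ((*v) A ` S) = dim S"
    using assms(1) by (intro dim_image_eq) (auto simp: span_eq_iff[THEN iffD2])
  then show ?thesis
    unfolding rank_dim_range by (metis dim_subset image_mono subset_UNIV)
qed

lemma eventually_uniformly_close:
  fixes A :: "real ^ 'n ^ 'm"
  assumes "(As \<longlongrightarrow> A) F" "0 < \<epsilon>"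
  shows "\<forall>\<^sub>F k in F. \<forall>x. norm x = 1 \<longrightarrow> \<bar>norm (As k *v x) - norm (A *v x)\<bar> < \<epsilon>"
  using tendstoD[OF assms]
proof eventually_elim
  case (elim k)
  show ?case
  proof safe
    fix x :: "real ^ 'n" assume x: "norm x = 1"
    have "\<bar>norm (As k *v x) - norm (A *v x)\<bar> \<le> norm ((As k - A) *v x)"
      by (metis matrix_vector_mult_diff_rdistrib norm_triangle_ineq3)
    also have "\<dots> \<le> norm (As k - A)" using norm_matrix_vector_mult_le[of "As k - A" x] x by simp
    finally show "\<bar>norm (As k *v x) - norm (A *v x)\<bar> < \<epsilon>" using elim by (simp add: dist_norm)
  qed
qed

lemma compact_subspace_sphere: "subspace S \<Longrightarrow> compact (S \<inter> sphere 0 1)"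
  for S :: "'a::euclidean_space set"
  by (simp add: closed_Int_compact closed_subspace)

text \<open>\<open>P\<close> is evaluated at normalised vectors throughout, so homogeneity of
  \<open>P\<close> need not be assumed.\<close>

lemma eq_zero_of_unit_vectors:
  fixes S :: "'a::real_normed_vector set"
  assumes "subspace S" "\<And>x. x \<in> S \<Longrightarrow> norm x = 1 \<Longrightarrow> \<not> P (sgn x)" "x \<in> S" "P (sgn x)"
  shows "x = 0"
proof (rule ccontr)
  assume "x \<noteq> 0"
  then have "sgn x \<in> S" "norm (sgn x) = 1" "sgn (sgn x) = sgn x"
    using assms(1,3) by (auto simp: sgn_div_norm subspace_scale norm_sgn)
  then show False using assms(2,4) by metis
qed

text \<open>\<open>A\<close> is injective on its row space, whose dimension is
  \<open>rank A\<close>, and by compactness is bounded below on the unit sphere there. A nearby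
  matrix remains injective on the same space.\<close>

lemma eventually_rank_ge:
  fixes A :: "real ^ 'n ^ 'm"
  assumes "(As \<longlongrightarrow> A) F"
  shows "\<forall>\<^sub>F k in F. rank A \<le> rank (As k)"
proof -
  define S where "S = range ((*v) (transpose A))"
  have S: "subspace S"
    unfolding S_def by (intro linear_subspace_image matrix_vector_mul_linear subspace_UNIV)
  have inj: "x = 0" if "x \<in> S" "A *v x = 0" for x
  proof -
    obtain y where "x = transpose A *v y" using \<open>x \<in> S\<close> by (auto simp: S_def)
    then have "x \<bullet> x = 0" using that(2) inner_matrix_vector_transpose[of A x y] by simp
    then show ?thesis by simp
  qed
  have "\<exists>q>0. \<forall>x\<in>S \<inter> sphere 0 1. q \<le> norm (A *v x)"
  proof (cases "S \<inter> sphere 0 1 = {}")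
    case True
    then show ?thesis by (intro exI[of _ 1]) auto
  next
    case False
    then obtain w where "w \<in> S \<inter> sphere 0 1"
        "\<forall>y\<in>S \<inter> sphere 0 1. norm (A *v w) \<le> norm (A *v y)"
      using continuous_attains_inf[OF compact_subspace_sphere[OF S] False continuous_on_norm_mult, of A]
      by blast
    then show ?thesis using inj[of w] by (intro exI[of _ "norm (A *v w)"]) auto
  qed
  then obtain q where q: "q > 0" "\<And>x. x \<in> S \<Longrightarrow> norm x = 1 \<Longrightarrow> q \<le> norm (A *v x)"
    by auto
  show ?thesis
    using eventually_uniformly_close[OF assms q(1)]
  proof eventually_elim
    case (elim k)
    have "x = 0" if x: "x \<in> S" "As k *v x = 0" for x
    proof (rule eq_zero_of_unit_vectors[where P = "\<lambda>x. As k *v x = 0", OF S _ x(1)])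
      show "As k *v sgn x = 0" using x by (simp add: sgn_div_norm matrix_vector_mult_scaleR)
      show "As k *v sgn x \<noteq> 0" if "x \<in> S" "norm x = 1" for x
        using elim q(2)[OF that] that by (fastforce simp: sgn_div_norm)
    qed
    then have "dim S \<le> rank (As k)" by (rule dim_le_rank_of_injective[OF S])
    then show ?case
      unfolding S_def by (metis rank_dim_range rank_transpose)
  qed
qed

text \<open>Strict contraction on the kernel of \<open>X\<close> is an open condition on
  \<open>G\<close>, so relative interiority is required of the limit alone. Each isometry space then
  eventually meets this kernel only in 0, which bounds its dimension.\<close>

lemma eventually_rank_le:
  fixes X G :: "real ^ 'n ^ 'm"
  assumes "G \<in> rel_interior (subdifferential nuclear_norm X)" and "(Gs \<longlongrightarrow> G) F"
    and "\<forall>\<^sub>F k in F. Gs k \<in> subdifferential nuclear_norm (Xs k)"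
  shows "\<forall>\<^sub>F k in F. rank (Xs k) \<le> rank X"
proof -
  define S where "S = {x. X *v x = 0}"
  have S: "subspace S"
    by (simp add: S_def subspace_def matrix_vector_right_distrib matrix_vector_mult_scaleR)
  have "contraction G"
    using assms(1) rel_interior_subset subdifferential_nuclear_norm_iff by blast
  then have less: "norm (G *v x) < 1" if "x \<in> S" "norm x = 1" for x
    using rel_interior_subdifferential_nuclear_norm[OF assms(1), of x] that
    by (metis S_def contraction_def mem_Collect_eq norm_zero order_less_le zero_neq_one)
  have "\<exists>q<1. \<forall>x\<in>S \<inter> sphere 0 1. norm (G *v x) \<le> q"
  proof (cases "S \<inter> sphere 0 1 = {}")
    case True
    then show ?thesis by (intro exI[of _ 0]) auto
  next
    case False
    then obtain w where "w \<in> S \<inter> sphere 0 1"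
        "\<forall>y\<in>S \<inter> sphere 0 1. norm (G *v y) \<le> norm (G *v w)"
      using continuous_attains_sup[OF compact_subspace_sphere[OF S] False continuous_on_norm_mult, of G]
      by blast
    then show ?thesis using less[of w] by (intro exI[of _ "norm (G *v w)"]) auto
  qed
  then obtain q where q: "q < 1" "\<And>x. x \<in> S \<Longrightarrow> norm x = 1 \<Longrightarrow> norm (G *v x) \<le> q"
    by auto
  have "0 < 1 - q" using q(1) by simp
  from eventually_uniformly_close[OF assms(2) this] assms(3) show ?thesis
  proof eventually_elim
    case (elim k)
    have "x = 0" if x: "x \<in> isometry_space (Gs k)" "X *v x = 0" for x
    proof (rule eq_zero_of_unit_vectors[where P = "\<lambda>x. norm (Gs k *v x) = norm x", OF S])
      show "x \<in> S" using x by (simp add: S_def)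
      show "norm (Gs k *v sgn x) = norm (sgn x)"
        using norm_isometry_space[OF x(1)]
        by (simp add: sgn_div_norm matrix_vector_mult_scaleR)
      show "norm (Gs k *v sgn x) \<noteq> norm (sgn x)" if "x \<in> S" "norm x = 1" for x
        using elim(1) q(2)[OF that] that by (fastforce simp: sgn_div_norm)
    qed
    then have "dim (isometry_space (Gs k)) \<le> rank X"
      by (rule dim_le_rank_of_injective[OF subspace_isometry_space])
    then show ?case using rank_le_dim_isometry_space[OF elim(2)] by simp
  qed
qed

subsection \<open>Inertial fixed-point iterations\<close>

text \<open>The positive parts \<theta> of the increments obey a recursion with factor at most
  \<open>q < 1\<close> and summable perturbation, so they are summable; subtracting their partial
  sums leaves a decreasing sequence bounded below. Summability of \<open>b\<close> follows by
  telescoping.\<close>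

lemma almost_decreasing_convergent:
  fixes \<phi> a b \<delta> :: "nat \<Rightarrow> real"
  assumes step: "\<And>k. \<phi> (k + 2) - \<phi> (k + 1) + b k \<le> a k * (\<phi> (k + 1) - \<phi> k) + \<delta> k"
    and nonneg: "\<And>k. 0 \<le> \<phi> k" "\<And>k. 0 \<le> b k" "\<And>k. 0 \<le> \<delta> k" "\<And>k. 0 \<le> a k"
    and q: "q < 1" "\<forall>\<^sub>F k in sequentially. a k \<le> q"
    and \<delta>: "summable \<delta>"
  shows "convergent \<phi>" and "summable b"
proof -
  define \<theta> where "\<theta> k = max 0 (\<phi> (k + 1) - \<phi> k)" for k
  have \<theta>0: "0 \<le> \<theta> k" for k by (simp add: \<theta>_def)
  have a\<theta>: "a k * (\<phi> (k + 1) - \<phi> k) \<le> a k * \<theta> k" for k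
    using nonneg(4) by (intro mult_left_mono) (auto simp: \<theta>_def)
  have \<theta>_step: "\<theta> (Suc k) \<le> a k * \<theta> k + \<delta> k" for k
    using step[of k] nonneg(2,3)[of k] mult_nonneg_nonneg[OF nonneg(4)[of k] \<theta>0[of k]] a\<theta>[of k]
    by (simp add: \<theta>_def[of "Suc k"])
  obtain N where N: "\<And>k. k \<ge> N \<Longrightarrow> a k \<le> q" using q(2) by (auto simp: eventually_sequentially)
  define D where "D = suminf (\<lambda>k. \<delta> (k + N))"
  have \<delta>N: "summable (\<lambda>k. \<delta> (k + N))" using \<delta> by (simp add: summable_iff_shift)
  have bound: "(\<Sum>k<n. \<theta> (k + N)) \<le> (\<theta> N + D) / (1 - q)" for n
  proof -
    \<comment> \<open>After shifting the index, the sum reappears on the right with factor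
      \<open>q\<close> and is absorbed on the left.\<close>
    have "(\<Sum>k<n. \<theta> (k + N)) \<le> (\<Sum>k<Suc n. \<theta> (k + N))" using \<theta>0 by simp
    also have "\<dots> = \<theta> N + (\<Sum>k<n. \<theta> (Suc (k + N)))" by (subst sum.lessThan_Suc_shift) simp
    also have "(\<Sum>k<n. \<theta> (Suc (k + N))) \<le> (\<Sum>k<n. q * \<theta> (k + N) + \<delta> (k + N))"
    proof (rule sum_mono)
      fix k
      have "a (k + N) * \<theta> (k + N) \<le> q * \<theta> (k + N)"
        using N \<theta>0 by (intro mult_right_mono) auto
      then show "\<theta> (Suc (k + N)) \<le> q * \<theta> (k + N) + \<delta> (k + N)" using \<theta>_step[of "k + N"] by simp
    qed
    also have "\<dots> \<le> q * (\<Sum>k<n. \<theta> (k + N)) + D"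
      using sum_le_suminf[OF \<delta>N, of "{..<n}"] nonneg(3)
      by (simp add: sum.distrib sum_distrib_left D_def)
    finally have "(1 - q) * (\<Sum>k<n. \<theta> (k + N)) \<le> \<theta> N + D" by (simp add: algebra_simps)
    then show ?thesis using q(1) by (simp add: field_simps)
  qed
  have "summable (\<lambda>k. \<theta> (k + N))"
    by (rule summableI_nonneg_bounded[OF \<theta>0 bound])
  then have \<theta>: "summable \<theta>" by (simp add: summable_iff_shift)
  define \<psi> where "\<psi> k = \<phi> k - (\<Sum>i<k. \<theta> i)" for k
  have "decseq \<psi>"
  proof (rule decseq_SucI)
    show "\<psi> (Suc k) \<le> \<psi> k" for k by (simp add: \<psi>_def \<theta>_def)
  qed
  moreover have "- suminf \<theta> \<le> \<psi> k" for k
    using sum_le_suminf[OF \<theta>, of "{..<k}"] \<theta>0 nonneg(1)[of k] by (simp add: \<psi>_def)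
  ultimately obtain l where "\<psi> \<longlonglongrightarrow> l" using decseq_convergent by metis
  then have "(\<lambda>k. \<psi> k + (\<Sum>i<k. \<theta> i)) \<longlonglongrightarrow> l + suminf \<theta>"
    using \<theta> by (intro tendsto_add summable_LIMSEQ)
  then show "convergent \<phi>" by (auto simp: \<psi>_def convergent_def)
  have "(\<lambda>k. \<phi> (Suc k)) \<longlonglongrightarrow> l + suminf \<theta>"
    using \<open>(\<lambda>k. \<psi> k + (\<Sum>i<k. \<theta> i)) \<longlonglongrightarrow> l + suminf \<theta>\<close> by (simp add: \<psi>_def LIMSEQ_Suc)
  then have "summable (\<lambda>k. \<phi> (Suc (Suc k)) - \<phi> (Suc k))"
    using telescope_summable by blast
  then have tel: "summable (\<lambda>k. (\<phi> (Suc k) - \<phi> (Suc (Suc k))))"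
    using summable_minus by fastforce
  have "summable (\<lambda>k. (\<phi> (Suc k) - \<phi> (Suc (Suc k))) + (\<theta> k + \<delta> k))"
    using tel \<theta> \<delta> by (intro summable_add)
  then show "summable b"
  proof (rule summable_comparison_test[rotated], intro exI[of _ N] allI impI)
    fix k assume "N \<le> k"
    then have "a k * \<theta> k \<le> 1 * \<theta> k" using N[of k] q(1) \<theta>0 by (intro mult_right_mono) auto
    then show "norm (b k) \<le> (\<phi> (Suc k) - \<phi> (Suc (Suc k))) + (\<theta> k + \<delta> k)"
      using step[of k] a\<theta>[of k] nonneg(2)[of k] by simp
  qed
qed

lemma norm_affine_combination:
  fixes u v :: "'a::real_inner"
  shows "(norm (u + a *\<^sub>R (u - v)))\<^sup>2
    = (1 + a) * (norm u)\<^sup>2 - a * (norm v)\<^sup>2 + a * (1 + a) * (norm (u - v))\<^sup>2"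
  unfolding power2_norm_eq_inner by (simp add: inner_simps inner_commute) algebra

text \<open>
  Summability of \<open>k * norm (e k)\<close>, rather than of \<open>norm (e k)\<close>, is what makes the cross terms
  \<open>norm (e k) * norm (y k - p)\<close> summable: a priori \<open>norm (y k - p)\<close> may grow linearly.
\<close>

lemma inertial_quasi_fejer:
  fixes x y e :: "nat \<Rightarrow> 'a::real_inner" and T :: "'a \<Rightarrow> 'a"
  assumes y: "\<And>k. y k = x (Suc k) + a k *\<^sub>R (x (Suc k) - x k)"
    and x: "\<And>k. x (Suc (Suc k)) = T (y k) + e k"
    and a: "\<And>k. 0 \<le> a k" "\<And>k. a k \<le> 1"
    and q: "q < 1" "\<forall>\<^sub>F k in sequentially. a k \<le> q"
    and inertia: "summable (\<lambda>k. a k * (norm (x (Suc k) - x k))\<^sup>2)"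
    and e: "summable (\<lambda>k. real k * norm (e k))"
    and c: "c > 0"
    and p: "\<And>z. (norm (T z - p))\<^sup>2 + c * (norm (z - T z))\<^sup>2 \<le> (norm (z - p))\<^sup>2"
  shows "convergent (\<lambda>k. norm (x k - p))"
    and "(\<lambda>k. y k - T (y k)) \<longlonglongrightarrow> 0"
proof -
  \<comment> \<open>The comparison starts at index 1, since the weight \<open>k\<close> vanishes at
    0.\<close>
  have e1: "summable (\<lambda>k. norm (e k))"
    by (rule summable_comparison_test[OF _ e], intro exI[of _ 1] allI impI)
      (auto simp: mult_le_cancel_right1)
  have Tp: "norm (T z - p) \<le> norm (z - p)" for z
  proof (rule power2_le_imp_le)
    have "0 \<le> c * (norm (z - T z))\<^sup>2" using c by simp
    then show "(norm (T z - p))\<^sup>2 \<le> (norm (z - p))\<^sup>2" using p[of z] by linarith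
  qed simp
  have nonneg: "0 \<le> a k * (norm (x (Suc k) - x k))\<^sup>2" for k using a(1) by simp
  obtain K1 where K1: "\<And>k. a k * (norm (x (Suc k) - x k))\<^sup>2 \<le> K1"
    using summable_imp_Bseq[OF inertia] nonneg by (auto simp: Bseq_def)
  obtain K2 where K2: "K2 > 0" "\<And>k. norm (e k) \<le> K2"
    using summable_imp_Bseq[OF e1] by (auto simp: Bseq_def)
  have "0 \<le> K1" using nonneg[of 0] K1[of 0] by linarith
  define C where "C = sqrt K1 + K2"
  have ad: "a k * norm (x (Suc k) - x k) \<le> sqrt K1" for k
  proof (rule real_le_rsqrt)
    have "(a k * norm (x (Suc k) - x k))\<^sup>2 = a k * (a k * (norm (x (Suc k) - x k))\<^sup>2)"
      by (simp add: power2_eq_square)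
    also have "\<dots> \<le> 1 * (a k * (norm (x (Suc k) - x k))\<^sup>2)"
      using a nonneg by (intro mult_right_mono) auto
    finally show "(a k * norm (x (Suc k) - x k))\<^sup>2 \<le> K1" using K1[of k] by simp
  qed
  have yp: "norm (y k - p) \<le> norm (x (Suc k) - p) + sqrt K1" for k
  proof -
    have "y k - p = (x (Suc k) - p) + a k *\<^sub>R (x (Suc k) - x k)" by (simp add: y)
    then have "norm (y k - p) \<le> norm (x (Suc k) - p) + norm (a k *\<^sub>R (x (Suc k) - x k))"
      using norm_triangle_ineq by metis
    then show ?thesis using ad[of k] a(1)[of k] by simp
  qed
  have xT: "norm (x (Suc (Suc k)) - p) \<le> norm (T (y k) - p) + norm (e k)" for k
    using norm_triangle_ineq[of "T (y k) - p" "e k"] by (simp add: x algebra_simps)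
  have growth: "norm (x (Suc k) - p) \<le> norm (x 1 - p) + real k * C" for k
  proof (induction k)
    case (Suc k)
    then show ?case
      using xT[of k] Tp[of "y k"] yp[of k] K2(2)[of k] by (simp add: C_def algebra_simps)
  qed simp
  define M where "M = norm (x 1 - p) + sqrt K1"
  \<comment> \<open>The first term comes from the extrapolation identity with
    \<open>1 + a k \<le> 2\<close>, the second from expanding the square of the perturbed
    step.\<close>
  define \<delta> where "\<delta> k = 2 * (a k * (norm (x (Suc k) - x k))\<^sup>2)
    + norm (e k) * (2 * norm (y k - p) + norm (e k))" for k
  have "summable (\<lambda>k. norm (e k) * (2 * norm (y k - p) + norm (e k)))"
  proof (rule summable_comparison_test, intro exI[of _ 0] allI impI)
    fix k
    have "norm (e k) * (2 * norm (y k - p) + norm (e k))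
        \<le> norm (e k) * (2 * (M + real k * C) + K2)"
      using yp[of k] growth[of k] K2(2)[of k] by (intro mult_left_mono) (auto simp: M_def)
    then show "norm (norm (e k) * (2 * norm (y k - p) + norm (e k)))
        \<le> (2 * M + K2) * norm (e k) + 2 * C * (real k * norm (e k))"
      by (simp add: algebra_simps)
  qed (intro summable_add summable_mult e e1)
  then have sum_\<delta>: "summable \<delta>"
    unfolding \<delta>_def by (intro summable_add summable_mult inertia)
  define \<phi> where "\<phi> k = (norm (x k - p))\<^sup>2" for k
  have step: "\<phi> (k + 2) - \<phi> (k + 1) + c * (norm (y k - T (y k)))\<^sup>2
      \<le> a k * (\<phi> (k + 1) - \<phi> k) + \<delta> k" for k
  proof -
    have "\<phi> (k + 2) \<le> (norm (T (y k) - p) + norm (e k))\<^sup>2"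
      using xT[of k] by (simp add: \<phi>_def power_mono)
    also have "\<dots> = (norm (T (y k) - p))\<^sup>2
        + norm (e k) * (2 * norm (T (y k) - p) + norm (e k))"
      by (simp add: power2_eq_square algebra_simps)
    also have "\<dots> \<le> (norm (T (y k) - p))\<^sup>2
        + norm (e k) * (2 * norm (y k - p) + norm (e k))"
      using Tp[of "y k"] by (intro add_left_mono mult_left_mono) auto
    finally have 1: "\<phi> (k + 2) + c * (norm (y k - T (y k)))\<^sup>2
        \<le> (norm (y k - p))\<^sup>2 + norm (e k) * (2 * norm (y k - p) + norm (e k))"
      using p[of "y k"] by simp
    have "y k - p = (x (Suc k) - p) + a k *\<^sub>R ((x (Suc k) - p) - (x k - p))" by (simp add: y)
    from this norm_affine_combination[of "x (Suc k) - p" "a k" "x k - p"] have 2: "(norm (y k - p))\<^sup>2 = (1 + a k) * \<phi> (k + 1) - a k * \<phi> k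
        + a k * (1 + a k) * (norm (x (Suc k) - x k))\<^sup>2"
      by (simp only: \<phi>_def) simp
    have "(1 + a k) * (a k * (norm (x (Suc k) - x k))\<^sup>2)
        \<le> 2 * (a k * (norm (x (Suc k) - x k))\<^sup>2)"
      using a(2)[of k] nonneg by (intro mult_right_mono) auto
    then show ?thesis using 1 2 by (simp add: \<delta>_def algebra_simps)
  qed
  have \<delta>0: "0 \<le> \<delta> k" for k unfolding \<delta>_def using nonneg[of k] by simp
  have \<phi>0: "0 \<le> \<phi> k" and "0 \<le> c * (norm (y k - T (y k)))\<^sup>2" for k
    using c by (simp_all add: \<phi>_def)
  note conv = almost_decreasing_convergent[OF step this \<delta>0 a(1) q sum_\<delta>]
  have "convergent \<phi>" and sum: "summable (\<lambda>k. c * (norm (y k - T (y k)))\<^sup>2)"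
    using conv by auto
  then obtain l where "\<phi> \<longlonglongrightarrow> l" by (auto simp: convergent_def)
  then have "(\<lambda>k. sqrt (\<phi> k)) \<longlonglongrightarrow> sqrt l" by (rule tendsto_real_sqrt)
  then show "convergent (\<lambda>k. norm (x k - p))" by (auto simp: \<phi>_def convergent_def)
  have "summable (\<lambda>k. (norm (y k - T (y k)))\<^sup>2)"
    using sum c by simp
  then have "(\<lambda>k. sqrt ((norm (y k - T (y k)))\<^sup>2)) \<longlonglongrightarrow> sqrt 0"
    by (intro tendsto_real_sqrt summable_LIMSEQ_zero)
  then show "(\<lambda>k. y k - T (y k)) \<longlonglongrightarrow> 0" by (simp add: tendsto_norm_zero_iff)
qed

text \<open>Opial's argument in finite dimension. The given fixed point \<open>p0\<close> yields
  boundedness and the vanishing residual; the quasi-Fejer estimate is then applied again at the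
  cluster point \<open>p\<close>, where the distance converges and tends to 0 along a
  subsequence.\<close>

lemma inertial_iteration_converges:
  fixes x y e :: "nat \<Rightarrow> 'a::euclidean_space" and T :: "'a \<Rightarrow> 'a"
  assumes y: "\<And>k. y k = x (Suc k) + a k *\<^sub>R (x (Suc k) - x k)"
    and x: "\<And>k. x (Suc (Suc k)) = T (y k) + e k"
    and a: "\<And>k. 0 \<le> a k" "\<And>k. a k \<le> 1"
    and q: "q < 1" "\<forall>\<^sub>F k in sequentially. a k \<le> q"
    and inertia: "summable (\<lambda>k. a k * (norm (x (Suc k) - x k))\<^sup>2)"
    and e: "summable (\<lambda>k. real k * norm (e k))"
    and c: "c > 0"
    and T: "\<And>p z. T p = p \<Longrightarrow> (norm (T z - p))\<^sup>2 + c * (norm (z - T z))\<^sup>2 \<le> (norm (z - p))\<^sup>2"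
    and "continuous_on UNIV T" and "T p0 = p0"
  obtains p where "T p = p" "x \<longlonglongrightarrow> p" "y \<longlonglongrightarrow> p"
proof -
  have fejer: "convergent (\<lambda>k. norm (x k - p))" "(\<lambda>k. y k - T (y k)) \<longlonglongrightarrow> 0" if "T p = p" for p
    using inertial_quasi_fejer[OF y x a q inertia e c T[OF that]] by auto
  note yT = fejer(2)[OF \<open>T p0 = p0\<close>]
  have "Bseq (\<lambda>k. norm (x k - p0))"
    using fejer(1)[OF \<open>T p0 = p0\<close>] by (rule convergent_imp_Bseq)
  then have "Bseq (\<lambda>k. x k - p0)" by (simp add: Bseq_def)
  then have "Bseq x" using Bseq_add[of "\<lambda>k. x k - p0" p0] by simp
  then have "Bseq (\<lambda>k. x (Suc k))" by (simp add: Bseq_Suc_iff)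
  then have "compact (closure (range (\<lambda>k. x (Suc k))))"
    by (simp add: Bseq_eq_bounded)
  then obtain p r where p: "strict_mono r" "((\<lambda>k. x (Suc k)) \<circ> r) \<longlonglongrightarrow> p"
    using compact_imp_seq_compact seq_compactE
    by (metis closure_subset range_subsetD)
  \<comment> \<open>Since (a k)^2 is at most \<open>a k\<close>, the summability hypothesis controls
    the squared inertial term; hence \<open>y\<close> and the shifted \<open>x\<close> share their
    cluster points.\<close>
  have "(\<lambda>k. a k *\<^sub>R (x (Suc k) - x k)) \<longlonglongrightarrow> 0"
  proof (rule Lim_null_comparison)
    show "(\<lambda>k. sqrt (a k * (norm (x (Suc k) - x k))\<^sup>2)) \<longlonglongrightarrow> 0"
      using tendsto_real_sqrt[OF summable_LIMSEQ_zero[OF inertia]] by simp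
    have "norm (a k *\<^sub>R (x (Suc k) - x k)) \<le> sqrt (a k * (norm (x (Suc k) - x k))\<^sup>2)" for k
    proof (rule real_le_rsqrt)
      show "(norm (a k *\<^sub>R (x (Suc k) - x k)))\<^sup>2 \<le> a k * (norm (x (Suc k) - x k))\<^sup>2"
        using mult_right_mono[OF mult_left_le[OF a(2,1)[of k]], of "(norm (x (Suc k) - x k))\<^sup>2"]
        by (simp add: power2_eq_square mult_ac)
    qed
    then show "\<forall>\<^sub>F k in sequentially.
        norm (a k *\<^sub>R (x (Suc k) - x k)) \<le> sqrt (a k * (norm (x (Suc k) - x k))\<^sup>2)" by simp
  qed
  then have yx: "(\<lambda>k. y k - x (Suc k)) \<longlonglongrightarrow> 0" by (simp add: y)
  have yp: "(\<lambda>k. y (r k)) \<longlonglongrightarrow> p"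
    using tendsto_add[OF LIMSEQ_subseq_LIMSEQ[OF yx p(1)] p(2)] by (simp add: o_def)
  then have "(\<lambda>k. T (y (r k))) \<longlonglongrightarrow> T p"
    using continuous_on_tendsto_compose[OF \<open>continuous_on UNIV T\<close> yp] by simp
  then have "(\<lambda>k. y (r k) - T (y (r k))) \<longlonglongrightarrow> p - T p" by (intro tendsto_diff yp)
  moreover have "(\<lambda>k. y (r k) - T (y (r k))) \<longlonglongrightarrow> 0"
    using LIMSEQ_subseq_LIMSEQ[OF yT p(1)] by (simp add: o_def)
  ultimately have "T p = p" using LIMSEQ_unique by fastforce
  then obtain l where l: "(\<lambda>k. norm (x (Suc k) - p)) \<longlonglongrightarrow> l"
    using fejer(1)[of p] LIMSEQ_Suc by (fastforce simp: convergent_def)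
  have "(\<lambda>k. norm (x (Suc (r k)) - p)) \<longlonglongrightarrow> 0"
    using p(2) by (simp add: o_def tendsto_norm_zero_iff LIM_zero_iff)
  then have "l = 0"
    using LIMSEQ_unique[OF LIMSEQ_subseq_LIMSEQ[OF l p(1)]] by (simp add: o_def)
  then have xp: "(\<lambda>k. x (Suc k)) \<longlonglongrightarrow> p"
    using l by (simp add: tendsto_norm_zero_iff LIM_zero_iff)
  show thesis
  proof
    show "T p = p" by fact
    show "x \<longlonglongrightarrow> p" using xp by (rule LIMSEQ_imp_Suc)
    show "y \<longlonglongrightarrow> p" using tendsto_add[OF yx xp] by simp
  qed
qed

subsection \<open>Forward-backward splitting\<close>

lemma attains_min_of_coercive:
  fixes f :: "'a::euclidean_space \<Rightarrow> real"
  assumes "continuous_on UNIV f" and "c > 0" and "\<And>x. c * norm (x - x0) \<le> f x + d"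
  obtains p where "\<And>x. f p \<le> f x"
proof -
  \<comment> \<open>Beyond this radius the linear lower bound already exceeds
    \<open>f x0\<close>.\<close>
  define r where "r = (f x0 + d) / c"
  have "0 \<le> r" using assms(2) assms(3)[of x0] by (simp add: r_def)
  moreover have "continuous_on (cball x0 r) f" using assms(1) continuous_on_subset by blast
  ultimately obtain p where p: "p \<in> cball x0 r" "\<And>x. x \<in> cball x0 r \<Longrightarrow> f p \<le> f x"
    using continuous_attains_inf[of "cball x0 r" f] by auto
  have "f p \<le> f x" for x
  proof (cases "x \<in> cball x0 r")
    case False
    then have "f x0 + d < c * norm (x - x0)"
      using assms(2) by (simp add: r_def dist_norm norm_minus_commute field_simps)
    then have "f x0 < f x" using assms(3)[of x] by simp
    moreover have "f p \<le> f x0" using p(2) \<open>0 \<le> r\<close> by simp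
    ultimately show ?thesis by simp
  qed (rule p)
  then show thesis using that by blast
qed

text \<open>Divide by \<open>t\<close> and let it tend to 0 from the right. The range of
  \<open>t\<close> is that of convex combinations.\<close>

lemma nonneg_of_linear_le_quadratic:
  fixes b c :: real
  assumes "\<And>t. 0 < t \<Longrightarrow> t < 1 \<Longrightarrow> 0 \<le> t * b + t\<^sup>2 * c"
  shows "0 \<le> b"
proof -
  have "\<forall>\<^sub>F t in at_right 0. t < (1::real)"
    using eventually_at_right_less[of "0::real"] by (auto simp: eventually_at_right_field intro!: exI[of _ 1])
  then have "\<forall>\<^sub>F t in at_right 0. 0 \<le> b + t * c"
    using eventually_at_right_less[of "0::real"]
  proof eventually_elim
    case (elim t)
    then have "0 \<le> t * (b + t * c)"
      using assms[of t] by (simp add: power2_eq_square algebra_simps)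
    then show ?case using elim by (simp add: zero_le_mult_iff)
  qed
  moreover have "((\<lambda>t. b + t * c) \<longlongrightarrow> b + 0 * c) (at_right 0)"
    by (intro tendsto_intros)
  ultimately show ?thesis
    using tendsto_lowerbound[of "\<lambda>t. b + t * c" "b + 0 * c" "at_right 0" 0] by simp
qed

text \<open>As \<open>prox\<close> is defined by a choice operator, a minimiser must first be shown
  to exist. Minimality gives the variational inequality along segments; uniqueness follows by adding
  the inequalities of two candidates.\<close>

lemma prox_iff:
  fixes h :: "'a::euclidean_space \<Rightarrow> real"
  assumes h: "convex_on UNIV h" "\<And>x. 0 \<le> h x" and "0 \<le> \<gamma>"
  shows "prox \<gamma> h y = p \<longleftrightarrow> (\<forall>z. (y - p) \<bullet> (z - p) \<le> \<gamma> * (h z - h p))"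
proof -
  define obj where "obj x = \<gamma> * h x + 1/2 * (norm (x - y))\<^sup>2" for x
  have "continuous_on UNIV obj"
    unfolding obj_def by (intro continuous_intros convex_on_continuous[OF open_UNIV h(1)])
  \<comment> \<open>Expand (|x - y| - 1)^2, which is nonnegative.\<close>
  moreover have "1 * norm (x - y) \<le> obj x + 1/2" for x
    using sum_squares_ge_zero[of "norm (x - y) - 1" 0] mult_nonneg_nonneg[OF \<open>0 \<le> \<gamma>\<close> h(2)[of x]]
    by (simp add: obj_def power2_eq_square algebra_simps)
  ultimately obtain p0 where "\<And>x. obj p0 \<le> obj x"
    using attains_min_of_coercive[of obj 1 y "1/2"] by auto
  then have "is_arg_min obj (\<lambda>_. True) p0" by (auto simp: is_arg_min_def not_less)
  then have "is_arg_min obj (\<lambda>_. True) (prox \<gamma> h y)"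
    unfolding prox_def arg_min_def obj_def by (rule someI)
  then have min: "obj (prox \<gamma> h y) \<le> obj x" for x by (auto simp: is_arg_min_def not_less)
  have vi: "(y - p) \<bullet> (z - p) \<le> \<gamma> * (h z - h p)" if p: "\<And>x. obj p \<le> obj x" for p z
  proof -
    have "0 \<le> \<gamma> * (h z - h p) - (y - p) \<bullet> (z - p)"
    proof (rule nonneg_of_linear_le_quadratic)
      fix t :: real assume t: "0 < t" "t < 1"
      have "h ((1 - t) *\<^sub>R p + t *\<^sub>R z) \<le> (1 - t) * h p + t * h z"
        using t by (intro convex_onD[OF h(1)]) auto
      then have "\<gamma> * h ((1 - t) *\<^sub>R p + t *\<^sub>R z) \<le> \<gamma> * ((1 - t) * h p + t * h z)"
        by (rule mult_left_mono) fact
      moreover have "(norm ((1 - t) *\<^sub>R p + t *\<^sub>R z - y))\<^sup>2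
          = (norm (p - y))\<^sup>2 - 2 * t * ((y - p) \<bullet> (z - p)) + t\<^sup>2 * (norm (z - p))\<^sup>2"
        by (simp add: power2_norm_eq_inner algebra_simps inner_commute power2_eq_square[of t])
      ultimately show "0 \<le> t * (\<gamma> * (h z - h p) - (y - p) \<bullet> (z - p)) + t\<^sup>2 * (1/2 * (norm (z - p))\<^sup>2)"
        using p[of "(1 - t) *\<^sub>R p + t *\<^sub>R z"] by (simp add: obj_def algebra_simps)
    qed
    then show ?thesis by simp
  qed
  have "prox \<gamma> h y = p" if p: "\<And>z. (y - p) \<bullet> (z - p) \<le> \<gamma> * (h z - h p)"
  proof -
    define p' where "p' = prox \<gamma> h y"
    have "(y - p) \<bullet> (p' - p) + (y - p') \<bullet> (p - p') \<le> 0"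
      using p[of p'] vi[of p' p] min by (simp add: p'_def algebra_simps)
    moreover have "(y - p) \<bullet> (p' - p) + (y - p') \<bullet> (p - p') = (norm (p' - p))\<^sup>2"
      by (simp add: power2_norm_eq_inner algebra_simps inner_commute)
    ultimately show ?thesis by (simp add: p'_def)
  qed
  then show ?thesis using vi[of "prox \<gamma> h y"] min by auto
qed

text \<open>Adding the two variational inequalities, each tested at the other's proximal point,
  cancels the values of \<open>h\<close>.\<close>

lemma prox_firmly_nonexpansive:
  fixes h :: "'a::euclidean_space \<Rightarrow> real"
  assumes h: "convex_on UNIV h" "\<And>x. 0 \<le> h x" and "0 \<le> \<gamma>"
  shows "(norm (prox \<gamma> h x - prox \<gamma> h y))\<^sup>2 + (norm ((x - prox \<gamma> h x) - (y - prox \<gamma> h y)))\<^sup>2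
    \<le> (norm (x - y))\<^sup>2"
proof -
  define u v where "u = prox \<gamma> h x" and "v = prox \<gamma> h y"
  have "(x - u) \<bullet> (v - u) \<le> \<gamma> * (h v - h u)" "(y - v) \<bullet> (u - v) \<le> \<gamma> * (h u - h v)"
    using prox_iff[OF assms, of x u] prox_iff[OF assms, of y v] by (auto simp: u_def v_def)
  then have "(x - u) \<bullet> (v - u) + (y - v) \<bullet> (u - v) \<le> 0" by (simp add: algebra_simps)
  moreover have "(norm (x - y))\<^sup>2 = (norm (u - v))\<^sup>2 + (norm ((x - u) - (y - v)))\<^sup>2
      - 2 * ((x - u) \<bullet> (v - u) + (y - v) \<bullet> (u - v))"
    by (simp add: power2_norm_eq_inner algebra_simps inner_commute)
  ultimately show ?thesis by (simp add: u_def v_def)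
qed

lemma continuous_on_prox:
  fixes h :: "'a::euclidean_space \<Rightarrow> real"
  assumes "convex_on UNIV h" "\<And>x. 0 \<le> h x" "0 \<le> \<gamma>"
  shows "continuous_on S (prox \<gamma> h)"
proof -
  have "norm (prox \<gamma> h x - prox \<gamma> h y) \<le> norm (x - y)" for x y
  proof (rule power2_le_imp_le)
    show "(norm (prox \<gamma> h x - prox \<gamma> h y))\<^sup>2 \<le> (norm (x - y))\<^sup>2"
      using prox_firmly_nonexpansive[OF assms, of x y]
        zero_le_power2[of "norm ((x - prox \<gamma> h x) - (y - prox \<gamma> h y))"] by linarith
  qed simp
  then show ?thesis
    unfolding continuous_on_iff dist_norm by (metis order_le_less_trans)
qed

text \<open>Firm nonexpansiveness leaves a surplus |s - \<gamma> D|^2 and cocoercivity a surplus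
  \<gamma> \<kappa> |D|^2, where \<open>s\<close> is the step and \<open>D\<close> the gradient
  difference. Together they dominate a multiple of |s|^2.\<close>

lemma forward_backward_quasi_nonexpansive:
  fixes h :: "'a::euclidean_space \<Rightarrow> real" and G :: "'a \<Rightarrow> 'a"
  assumes h: "convex_on UNIV h" "\<And>x. 0 \<le> h x" "0 \<le> \<mu>"
    and G: "\<And>x y. (norm (G x - G y))\<^sup>2 \<le> L * ((G x - G y) \<bullet> (x - y))"
    and "0 < L" "0 < \<gamma>" "\<gamma> < 2 / L"
  defines "T \<equiv> \<lambda>z. prox \<mu> h (z - \<gamma> *\<^sub>R G z)"
  obtains c where "c > 0"
    "\<And>p z. T p = p \<Longrightarrow> (norm (T z - p))\<^sup>2 + c * (norm (z - T z))\<^sup>2 \<le> (norm (z - p))\<^sup>2"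
proof -
  define \<kappa> where "\<kappa> = 2 / L - \<gamma>"
  \<comment> \<open>The two bounds give \<open>2 * c \<le> 1\<close> and 2 c \<gamma>^2 \<le>
    \<gamma> \<kappa>, the coefficients available for the two surplus terms.\<close>
  define c where "c = min (1/2) (\<kappa> / (2 * \<gamma>))"
  have \<kappa>: "0 < \<kappa>" and c: "0 < c" using assms(5-7) by (auto simp: \<kappa>_def c_def)
  have c2: "2 * c \<le> 1" by (simp add: c_def)
  have "c \<le> \<kappa> / (2 * \<gamma>)" by (simp add: c_def)
  then have c\<gamma>: "2 * c * \<gamma>\<^sup>2 \<le> \<gamma> * \<kappa>"
    using assms(6) by (simp add: field_simps power2_eq_square)
  show thesis
  proof
    show "c > 0" by fact
    fix p z assume p: "T p = p"
    define D where "D = G z - G p"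
    define s where "s = z - T z"
    have "(norm (T z - T p))\<^sup>2 + (norm ((z - \<gamma> *\<^sub>R G z - T z) - (p - \<gamma> *\<^sub>R G p - T p)))\<^sup>2
        \<le> (norm ((z - \<gamma> *\<^sub>R G z) - (p - \<gamma> *\<^sub>R G p)))\<^sup>2"
      unfolding T_def by (rule prox_firmly_nonexpansive[OF h])
    moreover have "(z - \<gamma> *\<^sub>R G z - T z) - (p - \<gamma> *\<^sub>R G p - T p) = s - \<gamma> *\<^sub>R D"
      by (simp add: p s_def D_def algebra_simps)
    moreover have "(z - \<gamma> *\<^sub>R G z) - (p - \<gamma> *\<^sub>R G p) = (z - p) - \<gamma> *\<^sub>R D"
      by (simp add: D_def algebra_simps)
    ultimately have 1: "(norm (T z - p))\<^sup>2 + (norm (s - \<gamma> *\<^sub>R D))\<^sup>2 \<le> (norm ((z - p) - \<gamma> *\<^sub>R D))\<^sup>2"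
      by (simp add: p)
    have 2: "(norm ((z - p) - \<gamma> *\<^sub>R D))\<^sup>2
        = (norm (z - p))\<^sup>2 - 2 * \<gamma> * (D \<bullet> (z - p)) + \<gamma>\<^sup>2 * (norm D)\<^sup>2"
      unfolding power2_norm_eq_inner
      by (simp add: inner_diff_left inner_diff_right inner_commute power2_eq_square algebra_simps)
    have "(norm D)\<^sup>2 / L \<le> D \<bullet> (z - p)"
      using G[of z p] assms(5) by (simp add: D_def field_simps)
    then have "2 * \<gamma> * ((norm D)\<^sup>2 / L) \<le> 2 * \<gamma> * (D \<bullet> (z - p))"
      using assms(6) by (intro mult_left_mono) auto
    then have 3: "\<gamma> * \<kappa> * (norm D)\<^sup>2 \<le> 2 * \<gamma> * (D \<bullet> (z - p)) - \<gamma>\<^sup>2 * (norm D)\<^sup>2"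
      by (simp add: \<kappa>_def algebra_simps power2_eq_square)
    have "(norm s)\<^sup>2 \<le> (norm (s - \<gamma> *\<^sub>R D) + norm (\<gamma> *\<^sub>R D))\<^sup>2"
      using norm_triangle_ineq[of "s - \<gamma> *\<^sub>R D" "\<gamma> *\<^sub>R D"] by (intro power_mono) auto
    also have "\<dots> \<le> 2 * (norm (s - \<gamma> *\<^sub>R D))\<^sup>2 + 2 * (norm (\<gamma> *\<^sub>R D))\<^sup>2"
      using sum_squares_bound[of "norm (s - \<gamma> *\<^sub>R D)" "norm (\<gamma> *\<^sub>R D)"]
      by (simp add: power2_sum)
    finally have "c * (norm s)\<^sup>2 \<le> c * (2 * (norm (s - \<gamma> *\<^sub>R D))\<^sup>2 + 2 * (norm (\<gamma> *\<^sub>R D))\<^sup>2)"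
      using c by (intro mult_left_mono) auto
    also have "\<dots> = 2 * c * (norm (s - \<gamma> *\<^sub>R D))\<^sup>2 + 2 * c * \<gamma>\<^sup>2 * (norm D)\<^sup>2"
      by (simp add: power_mult_distrib algebra_simps)
    also have "\<dots> \<le> 1 * (norm (s - \<gamma> *\<^sub>R D))\<^sup>2 + \<gamma> * \<kappa> * (norm D)\<^sup>2"
      using c2 c\<gamma> by (intro add_mono mult_right_mono) auto
    finally show "(norm (T z - p))\<^sup>2 + c * (norm (z - T z))\<^sup>2 \<le> (norm (z - p))\<^sup>2"
      using 1 2 3 by (simp add: s_def)
  qed
qed

text \<open>Both sides amount to nonnegativity of G p \<bullet> (z - p) + \<tau> (h z - h p) for all
  \<open>z\<close>. The lower bound on \<open>f\<close> expresses convexity; the quadratic upper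
  bound stands in for differentiability.\<close>

lemma forward_backward_fixed_point_iff:
  fixes h f :: "'a::euclidean_space \<Rightarrow> real"
  assumes h: "convex_on UNIV h" "\<And>x. 0 \<le> h x" and "0 < \<tau>" "0 < \<gamma>"
    and f: "\<And>x z. f x + G x \<bullet> (z - x) \<le> f z" "\<And>x z. f z \<le> f x + G x \<bullet> (z - x) + C * (norm (z - x))\<^sup>2"
  shows "prox (\<tau> * \<gamma>) h (p - \<gamma> *\<^sub>R G p) = p \<longleftrightarrow> (\<forall>z. f p + \<tau> * h p \<le> f z + \<tau> * h z)"
proof -
  have "prox (\<tau> * \<gamma>) h (p - \<gamma> *\<^sub>R G p) = p
      \<longleftrightarrow> (\<forall>z. (- \<gamma> *\<^sub>R G p) \<bullet> (z - p) \<le> (\<tau> * \<gamma>) * (h z - h p))"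
    using prox_iff[OF h, of "\<tau> * \<gamma>" "p - \<gamma> *\<^sub>R G p" p] assms(3,4) by simp
  also have "\<dots> \<longleftrightarrow> (\<forall>z. 0 \<le> \<gamma> * (G p \<bullet> (z - p) + \<tau> * (h z - h p)))"
    by (simp add: algebra_simps)
  also have "\<dots> \<longleftrightarrow> (\<forall>z. 0 \<le> G p \<bullet> (z - p) + \<tau> * (h z - h p))"
    using assms(4) by (simp add: zero_le_mult_iff)
  also have "\<dots> \<longleftrightarrow> (\<forall>z. f p + \<tau> * h p \<le> f z + \<tau> * h z)"
  proof (intro iffI allI)
    fix z assume "\<forall>z. 0 \<le> G p \<bullet> (z - p) + \<tau> * (h z - h p)"
    then have "0 \<le> G p \<bullet> (z - p) + \<tau> * (h z - h p)" by blast
    then show "f p + \<tau> * h p \<le> f z + \<tau> * h z" using f(1)[of p z] by (simp add: algebra_simps)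
  next
    fix z assume min: "\<forall>z. f p + \<tau> * h p \<le> f z + \<tau> * h z"
    show "0 \<le> G p \<bullet> (z - p) + \<tau> * (h z - h p)"
    proof (rule nonneg_of_linear_le_quadratic)
      fix t :: real assume t: "0 < t" "t < 1"
      define y where "y = (1 - t) *\<^sub>R p + t *\<^sub>R z"
      have y: "y - p = t *\<^sub>R (z - p)" by (simp add: y_def algebra_simps)
      have "\<tau> * h y \<le> \<tau> * ((1 - t) * h p + t * h z)"
        unfolding y_def using t assms(3) by (intro mult_left_mono convex_onD[OF h(1)]) auto
      moreover have "f y \<le> f p + t * (G p \<bullet> (z - p)) + C * (t\<^sup>2 * (norm (z - p))\<^sup>2)"
        using f(2)[of y p] unfolding y
        by (simp only: inner_scaleR_right norm_scaleR power_mult_distrib power2_abs)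
      moreover have "f p + \<tau> * h p \<le> f y + \<tau> * h y" using min by blast
      ultimately show "0 \<le> t * (G p \<bullet> (z - p) + \<tau> * (h z - h p)) + t\<^sup>2 * (C * (norm (z - p))\<^sup>2)"
        by (simp add: ring_distribs mult_ac)
    qed
  qed
  finally show ?thesis .
qed

section \<open>The weighted data-fidelity term and its gradient\<close>

lemma linear_hadamard: "linear (\<lambda>A. A \<odot> W)"
  by (rule linearI) (simp_all add: hadamard_def vec_eq_iff algebra_simps)

text \<open>Entrywise multiplication by \<open>W\<close> is self-adjoint; this is how the squared
  weight enters the gradient.\<close>

lemma inner_hadamard_hadamard: "(A \<odot> (W \<odot> W)) \<bullet> B = (A \<odot> W) \<bullet> (B \<odot> W)"
  by (simp add: hadamard_def inner_vec_def mult_ac)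

lemma norm_hadamard_le:
  fixes A W :: "real ^ 'n ^ 'm"
  assumes "\<And>i j. (W $ i $ j)\<^sup>2 \<le> M"
  shows "(norm (A \<odot> W))\<^sup>2 \<le> M * (norm A)\<^sup>2"
proof -
  have "(norm (A \<odot> W))\<^sup>2 = (\<Sum>i\<in>UNIV. \<Sum>j\<in>UNIV. (W $ i $ j)\<^sup>2 * (A $ i $ j)\<^sup>2)"
    unfolding power2_norm_eq_inner by (simp add: hadamard_def inner_vec_def power2_eq_square mult_ac)
  also have "\<dots> \<le> (\<Sum>i\<in>UNIV. \<Sum>j\<in>UNIV. M * (A $ i $ j)\<^sup>2)"
    using assms by (intro sum_mono mult_right_mono) auto
  also have "\<dots> = M * (norm A)\<^sup>2"
    unfolding power2_norm_eq_inner by (simp add: inner_vec_def power2_eq_square sum_distrib_left)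
  finally show ?thesis .
qed

definition fidelity_gradient ::
    "(real ^ 'n ^ 'm \<Rightarrow> real ^ 'l ^ 'd) \<Rightarrow> real ^ 'l ^ 'd \<Rightarrow> real ^ 'l ^ 'd \<Rightarrow> real ^ 'n ^ 'm \<Rightarrow> real ^ 'n ^ 'm"
  where "fidelity_gradient \<Psi> F W X = adjoint \<Psi> ((\<Psi> X - F) \<odot> (W \<odot> W))"

context
  fixes \<Psi> :: "real ^ 'n ^ 'm \<Rightarrow> real ^ 'l ^ 'd" and F W :: "real ^ 'l ^ 'd"
  assumes \<Psi>: "bounded_linear \<Psi>"
begin

lemma inner_fidelity_gradient:
  "fidelity_gradient \<Psi> F W X \<bullet> Z = ((\<Psi> X - F) \<odot> W) \<bullet> (\<Psi> Z \<odot> W)"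
  using adjoint_works[OF bounded_linear.linear[OF \<Psi>], of Z]
  by (simp add: fidelity_gradient_def inner_commute[of _ Z] inner_commute[of "\<Psi> Z"]
      inner_hadamard_hadamard)

lemma inner_fidelity_gradient_diff:
  "(fidelity_gradient \<Psi> F W X - fidelity_gradient \<Psi> F W Y) \<bullet> Z = (\<Psi> (X - Y) \<odot> W) \<bullet> (\<Psi> Z \<odot> W)"
proof -
  have "(\<Psi> X - F) \<odot> W - (\<Psi> Y - F) \<odot> W = \<Psi> (X - Y) \<odot> W"
    using linear_diff[OF linear_hadamard[of W], of "\<Psi> X - F" "\<Psi> Y - F"]
    by (simp add: linear_diff[OF bounded_linear.linear[OF \<Psi>]])
  moreover have "(fidelity_gradient \<Psi> F W X - fidelity_gradient \<Psi> F W Y) \<bullet> Z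
      = ((\<Psi> X - F) \<odot> W - (\<Psi> Y - F) \<odot> W) \<bullet> (\<Psi> Z \<odot> W)"
    by (simp only: inner_diff_left inner_fidelity_gradient)
  ultimately show ?thesis by (simp only:)
qed

text \<open>Write B for \<Psi> followed by multiplication by \<open>W\<close>, so that D = B* B (X -
  Y). Then |D|^4 is the square of B (X - Y) \<bullet> B D, hence at most (D \<bullet> (X - Y)) |B
  D|^2; bounding |B D|^2 by a multiple of |D|^2 and cancelling |D|^2 gives the claim.\<close>

lemma fidelity_gradient_cocoercive:
  assumes "\<And>i j. (W $ i $ j)\<^sup>2 \<le> M"
  shows "(norm (fidelity_gradient \<Psi> F W X - fidelity_gradient \<Psi> F W Y))\<^sup>2
    \<le> (onorm \<Psi>)\<^sup>2 * M * ((fidelity_gradient \<Psi> F W X - fidelity_gradient \<Psi> F W Y) \<bullet> (X - Y))"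
proof -
  define D where "D = fidelity_gradient \<Psi> F W X - fidelity_gradient \<Psi> F W Y"
  define H where "H = \<Psi> (X - Y) \<odot> W"
  have D: "D \<bullet> Z = H \<bullet> (\<Psi> Z \<odot> W)" for Z
    unfolding D_def H_def by (rule inner_fidelity_gradient_diff)
  have "0 \<le> M" using assms zero_le_power2 order_trans by blast
  have "(norm (\<Psi> D \<odot> W))\<^sup>2 \<le> M * (norm (\<Psi> D))\<^sup>2" by (rule norm_hadamard_le[OF assms])
  also have "\<dots> \<le> M * (onorm \<Psi> * norm D)\<^sup>2"
    using onorm[OF \<Psi>, of D] \<open>0 \<le> M\<close> by (intro mult_left_mono power_mono) auto
  finally have bound: "(norm (\<Psi> D \<odot> W))\<^sup>2 \<le> (onorm \<Psi>)\<^sup>2 * M * (norm D)\<^sup>2"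
    by (simp add: power_mult_distrib mult_ac)
  have "((norm D)\<^sup>2)\<^sup>2 = (H \<bullet> (\<Psi> D \<odot> W))\<^sup>2"
    using D[of D] by (simp add: power2_norm_eq_inner)
  also have "\<dots> \<le> (H \<bullet> H) * ((\<Psi> D \<odot> W) \<bullet> (\<Psi> D \<odot> W))" by (rule Cauchy_Schwarz_ineq)
  also have "\<dots> \<le> (H \<bullet> H) * ((onorm \<Psi>)\<^sup>2 * M * (norm D)\<^sup>2)"
    using bound by (intro mult_left_mono) (auto simp: power2_norm_eq_inner)
  also have "H \<bullet> H = D \<bullet> (X - Y)" using D[of "X - Y"] by (simp add: H_def)
  finally have "(norm D)\<^sup>2 * (norm D)\<^sup>2 \<le> ((onorm \<Psi>)\<^sup>2 * M * (D \<bullet> (X - Y))) * (norm D)\<^sup>2"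
    by (simp add: power2_eq_square mult_ac)
  then have "(norm D)\<^sup>2 \<le> (onorm \<Psi>)\<^sup>2 * M * (D \<bullet> (X - Y))"
    by (cases "D = 0") (simp, erule mult_right_le_imp_le, simp)
  then show ?thesis by (simp add: D_def)
qed

text \<open>Exact because the function is quadratic; the sign and the size of the remainder give the
  two bounds needed for the fixed-point characterisation.\<close>

lemma data_fidelity_expansion:
  "data_fidelity \<Psi> F W Z = data_fidelity \<Psi> F W X + fidelity_gradient \<Psi> F W X \<bullet> (Z - X)
    + 1/2 * (norm (\<Psi> (Z - X) \<odot> W))\<^sup>2"
proof -
  have "(\<Psi> Z - F) \<odot> W = (\<Psi> X - F) \<odot> W + \<Psi> (Z - X) \<odot> W"
    using linear_add[OF linear_hadamard[of W], of "\<Psi> X - F" "\<Psi> (Z - X)"]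
    by (simp add: linear_diff[OF bounded_linear.linear[OF \<Psi>]])
  then show ?thesis
    unfolding data_fidelity_def inner_fidelity_gradient power2_norm_eq_inner
    by (simp add: inner_add_left inner_add_right inner_commute)
qed

lemma continuous_on_fidelity_residual: "continuous_on S (\<lambda>X. (\<Psi> X - F) \<odot> V)"
proof -
  have "continuous_on UNIV (\<lambda>A. A \<odot> V)"
    by (rule linear_continuous_on[OF linear_conv_bounded_linear[THEN iffD1, OF linear_hadamard]])
  moreover have "continuous_on S (\<lambda>X. \<Psi> X - F)"
    by (intro continuous_intros linear_continuous_on \<Psi>)
  ultimately show ?thesis by (rule continuous_on_compose2) simp
qed

lemma continuous_on_data_fidelity: "continuous_on S (data_fidelity \<Psi> F W)"
  unfolding data_fidelity_def[abs_def] by (intro continuous_intros continuous_on_fidelity_residual)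

lemma continuous_on_fidelity_gradient: "continuous_on S (fidelity_gradient \<Psi> F W)"
proof -
  have "continuous_on UNIV (adjoint \<Psi>)"
    using adjoint_linear[OF bounded_linear.linear[OF \<Psi>]]
    by (simp add: linear_conv_bounded_linear linear_continuous_on)
  then show ?thesis
    unfolding fidelity_gradient_def[abs_def]
    by (rule continuous_on_compose2) (auto intro: continuous_on_fidelity_residual)
qed

lemma forward_backward_fixed_point_iff_minimiser:
  assumes "0 < \<tau>" "0 < \<gamma>"
  shows "prox (\<tau> * \<gamma>) nuclear_norm (X - \<gamma> *\<^sub>R fidelity_gradient \<Psi> F W X) = X
    \<longleftrightarrow> is_arg_min (\<lambda>X. data_fidelity \<Psi> F W X + \<tau> * nuclear_norm X) (\<lambda>_. True) X"
proof -
  have "bounded_linear (\<lambda>D. \<Psi> D \<odot> W)"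
    using bounded_linear_compose[OF linear_conv_bounded_linear[THEN iffD1, OF linear_hadamard] \<Psi>] .
  then have "\<exists>C. \<forall>D. norm (\<Psi> D \<odot> W) \<le> norm D * C"
    by (auto dest: bounded_linear.bounded)
  then obtain C where C: "\<And>D. norm (\<Psi> D \<odot> W) \<le> norm D * C" by blast
  have "(norm (\<Psi> D \<odot> W))\<^sup>2 \<le> C\<^sup>2 * (norm D)\<^sup>2" for D
    using power_mono[OF C[of D], of 2] by (simp add: power_mult_distrib mult_ac)
  then have "data_fidelity \<Psi> F W Z \<le> data_fidelity \<Psi> F W X + fidelity_gradient \<Psi> F W X \<bullet> (Z - X)
      + (1/2 * C\<^sup>2) * (norm (Z - X))\<^sup>2" for X Z
    unfolding data_fidelity_expansion[of Z X] by simp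
  moreover have "data_fidelity \<Psi> F W X + fidelity_gradient \<Psi> F W X \<bullet> (Z - X) \<le> data_fidelity \<Psi> F W Z"
    for X Z
    unfolding data_fidelity_expansion[of Z X] by simp
  ultimately have "prox (\<tau> * \<gamma>) nuclear_norm (X - \<gamma> *\<^sub>R fidelity_gradient \<Psi> F W X) = X
      \<longleftrightarrow> (\<forall>Z. data_fidelity \<Psi> F W X + \<tau> * nuclear_norm X \<le> data_fidelity \<Psi> F W Z + \<tau> * nuclear_norm Z)"
    by (intro forward_backward_fixed_point_iff[OF convex_on_nuclear_norm nuclear_norm_nonneg assms])
  then show ?thesis by (simp add: is_arg_min_def not_less)
qed

text \<open>The penalty dominates \<tau> times the Frobenius norm, so the objective is coercive. The
  minimiser serves as the initial fixed point in the convergence argument.\<close>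

lemma regularised_fidelity_minimiser_exists:
  assumes "0 < \<tau>"
  shows "\<exists>X. is_arg_min (\<lambda>X. data_fidelity \<Psi> F W X + \<tau> * nuclear_norm X) (\<lambda>_. True) X"
proof -
  have "continuous_on UNIV (\<lambda>X. data_fidelity \<Psi> F W X + \<tau> * nuclear_norm X)"
    by (intro continuous_intros continuous_on_data_fidelity continuous_on_nuclear_norm)
  moreover have "\<tau> * norm (X - 0) \<le> data_fidelity \<Psi> F W X + \<tau> * nuclear_norm X + 0" for X
    using mult_left_mono[OF norm_le_nuclear_norm[of X], of \<tau>] assms
    by (simp add: data_fidelity_def add_increasing)
  ultimately obtain X where "\<And>Z. data_fidelity \<Psi> F W X + \<tau> * nuclear_norm X
      \<le> data_fidelity \<Psi> F W Z + \<tau> * nuclear_norm Z"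
    using attains_min_of_coercive assms by blast
  then show ?thesis by (auto simp: is_arg_min_def not_less)
qed

end

section \<open>Convergence and rank identification for ProGrAMMe\<close>

theorem theorem3p2:
  fixes \<Psi> :: "real ^ 'n ^ 'm \<Rightarrow> real ^ 'l ^ 'd"
    and F W Wt :: "real ^ 'l ^ 'd"
    and \<tau> \<gamma> L :: real
    and I :: nat
    and a :: "nat \<Rightarrow> real"
    and X' :: "real ^ 'n ^ 'm"
    and X Y Z R e :: "nat \<Rightarrow> real ^ 'n ^ 'm"
    and U :: "nat \<Rightarrow> nat \<Rightarrow> real ^ 'r ^ 'm"
    and V :: "nat \<Rightarrow> nat \<Rightarrow> real ^ 'n ^ 'r"
  assumes "bounded_linear \<Psi>"
    and "\<And>i j. 0 \<le> W $ i $ j"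
    and "Wt = W \<odot> W"
    and "0 < \<tau>"
    and "L = (onorm \<Psi>)\<^sup>2 * Max {Wt $ i $ j | i j. True}"
    and "0 < L"
    and "0 < \<gamma>" and "\<gamma> < 2 / L"
    and "1 \<le> I"
    and "\<And>k. 0 \<le> a k \<and> a k \<le> 1"
    and "ProGrAMMe \<Psi> F Wt \<gamma> \<tau> I a X' X Y Z U V"
    and "\<And>k. R (Suc k) = prox (\<tau> * \<gamma>) nuclear_norm (Z k)"
    and "\<And>k. e k = X (Suc k) - R (Suc k)"
    and "limsup (\<lambda>k. ereal (a k)) < 1"
    and "summable (\<lambda>k. a k * (norm (X k - prev_iter X' X k))\<^sup>2)"
    and "summable (\<lambda>k. real k * norm (e k))"
  shows "\<exists>Xs. R \<longlonglongrightarrow> Xs \<and>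
           is_arg_min (\<lambda>X. data_fidelity \<Psi> F W X + \<tau> * nuclear_norm X) (\<lambda>_. True) Xs \<and>
           (- adjoint \<Psi> ((\<Psi> Xs - F) \<odot> Wt)
              \<in> (\<lambda>G. \<tau> *\<^sub>R G) ` rel_interior (subdifferential nuclear_norm Xs) \<longrightarrow>
            (\<exists>K>0. \<forall>k\<ge>K. rank (R k) = rank Xs))"
proof -
  let ?G = "fidelity_gradient \<Psi> F W"
  \<comment> \<open>\<open>?x 0\<close> is the extra starting point and \<open>?x (Suc k)\<close> is
    \<open>X k\<close>, which matches the shifted indices of the abstract iteration.\<close>
  let ?x = "prev_iter X' X"
  define T where "T Z = prox (\<tau> * \<gamma>) nuclear_norm (Z - \<gamma> *\<^sub>R ?G Z)" for Z
  define M where "M = Max {Wt $ i $ j | i j. True}"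
  note \<Psi> = \<open>bounded_linear \<Psi>\<close>
  note nn = nuclear_norm_nonneg
  have "{Wt $ i $ j | i j. True} = (\<lambda>(i, j). Wt $ i $ j) ` UNIV" by auto
  then have "finite {Wt $ i $ j | i j. True}" by simp
  then have "Wt $ i $ j \<le> M" for i j unfolding M_def by (rule Max_ge) blast
  then have W: "(W $ i $ j)\<^sup>2 \<le> M" for i j
    using \<open>Wt = W \<odot> W\<close> by (simp add: hadamard_def power2_eq_square)
  have L: "L = (onorm \<Psi>)\<^sup>2 * M" using assms(5) by (simp add: M_def)
  have pos: "0 \<le> \<tau> * \<gamma>" "0 < \<tau> * \<gamma>" using \<open>0 < \<tau>\<close> \<open>0 < \<gamma>\<close> by simp_all
  obtain c where c: "c > 0"
    "\<And>P Z. T P = P \<Longrightarrow> (norm (T Z - P))\<^sup>2 + c * (norm (Z - T Z))\<^sup>2 \<le> (norm (Z - P))\<^sup>2"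
    using forward_backward_quasi_nonexpansive[OF convex_on_nuclear_norm nn pos(1)
        fidelity_gradient_cocoercive[OF \<Psi> W, folded L] \<open>0 < L\<close> \<open>0 < \<gamma>\<close> \<open>\<gamma> < 2 / L\<close>]
    unfolding T_def by blast
  have T_iff: "T P = P \<longleftrightarrow>
      is_arg_min (\<lambda>X. data_fidelity \<Psi> F W X + \<tau> * nuclear_norm X) (\<lambda>_. True) P" for P
    unfolding T_def
    by (rule forward_backward_fixed_point_iff_minimiser[OF \<Psi> \<open>0 < \<tau>\<close> \<open>0 < \<gamma>\<close>])
  obtain P0 where P0: "T P0 = P0"
    using regularised_fidelity_minimiser_exists[OF \<Psi> \<open>0 < \<tau>\<close>] T_iff by blast
  have contT: "continuous_on UNIV T"
    unfolding T_def[abs_def]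
    by (rule continuous_on_compose2[OF continuous_on_prox[OF convex_on_nuclear_norm nn pos(1)]])
      (auto intro!: continuous_intros continuous_on_fidelity_gradient \<Psi>)
  have Y: "Y k = ?x (Suc k) + a k *\<^sub>R (?x (Suc k) - ?x k)"
    and Z: "Z k = Y k - \<gamma> *\<^sub>R ?G (Y k)" for k
    using \<open>ProGrAMMe _ _ _ _ _ _ _ _ _ _ _ _ _\<close> \<open>Wt = W \<odot> W\<close>
    by (simp_all add: ProGrAMMe_def fidelity_gradient_def prev_iter_def)
  \<comment> \<open>The inner alternating minimisation is treated as an inexact proximal step with
    error \<open>e k\<close>.\<close>
  have step: "?x (Suc (Suc k)) = T (Y k) + e k" for k
    using assms(12,13)[of k] by (simp add: prev_iter_def T_def Z)
  obtain q :: real where q: "limsup (\<lambda>k. ereal (a k)) < ereal q" "q < 1"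
    using ereal_dense2[OF assms(14)] by (metis one_ereal_def ereal_less_eq(3) less_ereal.simps(1))
  then have "\<forall>\<^sub>F k in sequentially. ereal (a k) < ereal q" by (intro Limsup_lessD)
  then have aq: "\<forall>\<^sub>F k in sequentially. a k \<le> q" by eventually_elim simp
  obtain Xs where Xs: "T Xs = Xs" "?x \<longlonglongrightarrow> Xs" "Y \<longlonglongrightarrow> Xs"
  proof (rule inertial_iteration_converges[OF Y step _ _ q(2) aq _ assms(16) c contT P0])
    show "summable (\<lambda>k. a k * (norm (?x (Suc k) - ?x k))\<^sup>2)"
      using assms(15) by (simp add: prev_iter_def)
  qed (use assms(10) in auto)
  have "T (Y k) = R (Suc k)" for k using assms(12)[of k] by (simp add: T_def Z)
  moreover have "(\<lambda>k. T (Y k)) \<longlonglongrightarrow> T Xs"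
    using continuous_on_tendsto_compose[OF contT Xs(3)] by simp
  ultimately have RS: "(\<lambda>k. R (Suc k)) \<longlonglongrightarrow> Xs" using Xs(1) by simp
  \<comment> \<open>The optimality condition of the proximal step makes this a subgradient at
    \<open>R (Suc k)\<close>; its limit is the negative gradient at \<open>Xs\<close> divided by
    \<tau>, the matrix in the non-degeneracy condition.\<close>
  define g where "g k = (1 / (\<tau> * \<gamma>)) *\<^sub>R (Z k - R (Suc k))" for k
  have g: "g k \<in> subdifferential nuclear_norm (R (Suc k))" for k
  proof -
    have "(Z k - R (Suc k)) \<bullet> (A - R (Suc k))
        \<le> \<tau> * \<gamma> * (nuclear_norm A - nuclear_norm (R (Suc k)))" for A
      using prox_iff[OF convex_on_nuclear_norm nn pos(1), of "Z k" "R (Suc k)"] assms(12)[of k]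
      by simp
    then have "g k \<bullet> (A - R (Suc k)) \<le> nuclear_norm A - nuclear_norm (R (Suc k))" for A
      using pos(2) by (simp add: g_def pos_divide_le_eq mult.commute)
    then show ?thesis by (simp add: subdifferential_def algebra_simps)
  qed
  have "(\<lambda>k. ?G (Y k)) \<longlonglongrightarrow> ?G Xs"
    using continuous_on_tendsto_compose[OF continuous_on_fidelity_gradient[OF \<Psi>, of UNIV] Xs(3)]
    by simp
  then have "g \<longlonglongrightarrow> (1 / (\<tau> * \<gamma>)) *\<^sub>R ((Xs - \<gamma> *\<^sub>R ?G Xs) - Xs)"
    unfolding g_def Z by (intro tendsto_intros Xs(3) RS)
  then have g_lim: "g \<longlonglongrightarrow> (1 / \<tau>) *\<^sub>R (- ?G Xs)" using \<open>0 < \<gamma>\<close> by simp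
  have "\<exists>K>0. \<forall>k\<ge>K. rank (R k) = rank Xs"
    if "- ?G Xs \<in> (\<lambda>G. \<tau> *\<^sub>R G) ` rel_interior (subdifferential nuclear_norm Xs)"
  proof -
    have "(1 / \<tau>) *\<^sub>R (- ?G Xs) \<in> rel_interior (subdifferential nuclear_norm Xs)"
    proof -
      from that obtain G where G: "- ?G Xs = \<tau> *\<^sub>R G"
          "G \<in> rel_interior (subdifferential nuclear_norm Xs)"
        by blast
      show ?thesis unfolding G(1) using G(2) \<open>0 < \<tau>\<close> by simp
    qed
    then have "\<forall>\<^sub>F k in sequentially. rank (R (Suc k)) \<le> rank Xs"
      using g_lim g by (intro eventually_rank_le[where Gs = g]) auto
    with eventually_rank_ge[OF RS]
    have "\<forall>\<^sub>F k in sequentially. rank (R (Suc k)) = rank Xs"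
      by eventually_elim simp
    then obtain N where N: "\<And>k. k \<ge> N \<Longrightarrow> rank (R (Suc k)) = rank Xs"
      by (auto simp: eventually_sequentially)
    \<comment> \<open>\<open>R 0\<close> is not determined by the iteration; the threshold
      \<open>Suc N\<close> skips it and is positive.\<close>
    have "rank (R k) = rank Xs" if "k \<ge> Suc N" for k
      using N[of "k - 1"] that by simp
    then show ?thesis by blast
  qed
  moreover have "R \<longlonglongrightarrow> Xs" using RS by (rule LIMSEQ_imp_Suc)
  moreover have "- ?G Xs = - adjoint \<Psi> ((\<Psi> Xs - F) \<odot> Wt)"
    using \<open>Wt = W \<odot> W\<close> by (simp add: fidelity_gradient_def)
  ultimately show ?thesis using Xs(1) T_iff by auto
qed

end
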